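(* Consider the problem $\min_{x\in\mathbb R^n} f(x)$ subject to $Ax=b$, where $f:\mathbb R^n\to\mathbb R$ is convex and continuously differentiable, $A\in\mathbb R^{m\times n}$, $b\in\mathbb R^m$, and assume the KKT set $\Omega$ is nonempty. Let $\{(x_k,\lambda_k)\}_{k\ge0}$ be generated by the accelerated augmented Lagrangian method described in the context (in either Case I or Case II). Then there exists $(x^*,\lambda^* )\in\Omega$ such that $(x_k,\lambda_k)\to(x^*,\lambda^* )$ as $k\to+\infty$.
   Context: The KKT set is $\Omega=\{(x^*,\lambda^* )\in\mathbb R^n\times\mathbb R^m: Ax^*=b,\ \nabla f(x^* )+A^\top\lambda^*=0\}$. Parameter sequence: $\{t_k\}_{k\ge1}$ is nondecreasing, $t_1=1$, $t_k>1$ for all $k>2$, $t_k\to+\infty$, and $t_{k+1}^2-t_k^2\le\rho t_{k+1}$ for all $k\ge 1$, with fixed $\rho\in(0,1]$. Fix $\eta\in[\rho,1]$, $\gamma>0$, $\delta>0$, $\beta\ge0$. Algorithm: initial points $x_0=x_1\in\mathbb R^n$, $\lambda_0=\lambda_1\in\mathbb R^m$. For $k=1,2,\dots$: set $\alpha_k=(t_{k+1}-\eta)/\eta$, $c_k=t_{k+1}/\eta$, $\bar x_k=x_k+\frac{t_k-1}{t_{k+1}}(x_k-x_{k-1})$, $\bar\lambda_k=\lambda_k+\frac{t_k-1}{t_{k+1}}(\lambda_k-\lambda_{k-1})$, $p_k=c_k\bar\lambda_k-\alpha_k\lambda_k$, $r_k=\alpha_kAx_k+b$. Case I ($f$ convex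 and $C^1$): $x_{k+1}=\arg\min_{x}\{f(x)+\frac\beta2\|Ax-b\|^2+\frac1{2\gamma}\|x-\bar x_k\|^2+\langle p_k,Ax-b\rangle+\frac\delta2\|c_kAx-r_k\|^2\}$. Case II ($f$ convex with $L$-Lipschitz gradient, and $\gamma\le 1/L$): $x_{k+1}=\arg\min_{x}\{\langle\nabla f(\bar x_k),x\rangle+\frac\beta2\|Ax-b\|^2+\frac1{2\gamma}\|x-\bar x_k\|^2+\langle p_k,Ax-b\rangle+\frac\delta2\|c_kAx-r_k\|^2\}$. Then $\lambda_{k+1}=\bar\lambda_k+\delta(c_kAx_{k+1}-r_k)$. *)

theory Defs
  imports "HOL-Analysis.Analysis"
begin

text \<open>Vectors in R^n are real^'n, in R^m are real^'m; A is an m x n matrix (real^'n^'m).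
  The gradient of f is given as a function grad_f with
  (f has_derivative (\<lambda>h. grad_f x \<bullet> h)) (at x).\<close>

definition kkt_set ::
  "real^'n^'m \<Rightarrow> real^'m \<Rightarrow> (real^'n \<Rightarrow> real^'n) \<Rightarrow> ((real^'n) \<times> (real^'m)) set" where
  "kkt_set A b grad_f =
     {(xs, ls). A *v xs = b \<and> grad_f xs + transpose A *v ls = 0}"

text \<open>Subproblem objective: g is the smooth part (f in Case I, the linearization
  y \<mapsto> <grad f(xbar), y> in Case II).\<close>
definition aalm_obj ::
  "(real^'n \<Rightarrow> real) \<Rightarrow> real^'n^'m \<Rightarrow> real^'m \<Rightarrow> real \<Rightarrow> real \<Rightarrow> real \<Rightarrow>
   real^'n \<Rightarrow> real^'m \<Rightarrow> real \<Rightarrow> real^'m \<Rightarrow> real^'n \<Rightarrow> real" where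
  "aalm_obj g A b \<beta> \<gamma> \<delta> xbar p c r y =
     g y + \<beta> / 2 * (norm (A *v y - b))\<^sup>2 + 1 / (2 * \<gamma>) * (norm (y - xbar))\<^sup>2
     + p \<bullet> (A *v y - b) + \<delta> / 2 * (norm (c *\<^sub>R (A *v y) - r))\<^sup>2"

text \<open>One iteration k (k \<ge> 1) of the accelerated augmented Lagrangian method.
  The parameter G maps the extrapolated point xbar_k to the smooth part g used
  in the subproblem.\<close>
definition aalm_step ::
  "(real^'n \<Rightarrow> real^'n \<Rightarrow> real) \<Rightarrow> real^'n^'m \<Rightarrow> real^'m \<Rightarrow> (nat \<Rightarrow> real) \<Rightarrow>
   real \<Rightarrow> real \<Rightarrow> real \<Rightarrow> real \<Rightarrow> (nat \<Rightarrow> real^'n) \<Rightarrow> (nat \<Rightarrow> real^'m) \<Rightarrow> nat \<Rightarrow> bool" where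
  "aalm_step G A b t \<eta> \<beta> \<gamma> \<delta> x l k \<longleftrightarrow>
     (let \<alpha> = (t (k+1) - \<eta>) / \<eta>;
          c = t (k+1) / \<eta>;
          xb = x k + ((t k - 1) / t (k+1)) *\<^sub>R (x k - x (k-1));
          lb = l k + ((t k - 1) / t (k+1)) *\<^sub>R (l k - l (k-1));
          p = c *\<^sub>R lb - \<alpha> *\<^sub>R l k;
          r = \<alpha> *\<^sub>R (A *v x k) + b
      in (\<forall>y. aalm_obj (G xb) A b \<beta> \<gamma> \<delta> xb p c r (x (k+1))
               \<le> aalm_obj (G xb) A b \<beta> \<gamma> \<delta> xb p c r y)
         \<and> l (k+1) = lb + \<delta> *\<^sub>R (c *\<^sub>R (A *v x (k+1)) - r))"

end

theory Submission
  imports Defs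
begin

text \<open>
  Write \<open>z\<^sub>k = (x\<^sub>k, \<lambda>\<^sub>k)\<close>. For a KKT point \<open>z*\<close> put \<open>u\<^sub>k = \<eta> (z\<^sub>k - z*) + (t\<^sub>k - 1) (z\<^sub>k - z\<^sub>k\<^sub>-\<^sub>1)\<close>. The energy
  \<open>2 t\<^sub>k\<^sup>2 (L(x\<^sub>k, \<lambda>*) - L(x*, \<lambda>*)) + |u\<^sub>k|\<^sup>2 + \<eta> (1 - \<eta>) |z\<^sub>k - z*|\<^sup>2\<close>, with \<open>L\<close> the augmented Lagrangian
  and norms weighted by \<open>1 / \<gamma>\<close> and \<open>1 / \<delta>\<close>, is nonincreasing: the bilinear terms of the primal and
  dual steps cancel. Hence the iterates are bounded and \<open>L(x\<^sub>k, \<lambda>*)\<close> tends to \<open>L(x*, \<lambda>*)\<close>.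

  Both \<open>A x\<^sub>k - b\<close> and \<open>A\<^sup>T (\<lambda>\<^sub>k - \<lambda>*)\<close> satisfy an averaging recursion with weights \<open>\<eta> / t\<^sub>k\<close>. Since
  \<open>t\<^sub>k\<close> grows at most linearly these weights are not summable, both quantities tend to zero, and
  every cluster point of \<open>z\<^sub>k\<close> is a KKT point.

  For two KKT points the difference of the energies is affine in the iterates and equals
  \<open>2 \<eta> (a\<^sub>k + (t\<^sub>k - 1) (a\<^sub>k - a\<^sub>k\<^sub>-\<^sub>1))\<close> up to a constant, where \<open>a\<^sub>k\<close> is the inner product of \<open>z\<^sub>k\<close> with the
  difference of the two points. It converges, so \<open>a\<^sub>k\<close> converges by averaging again, and
  two distinct cluster points are impossible.
\<close>

section \<open>Convexity, averaging and cluster points\<close>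

lemma inner_transpose_left:
  fixes A :: "real^'n^'m"
  shows "(transpose A *v y) \<bullet> z = y \<bullet> (A *v z)"
  by (simp add: dot_lmul_matrix)

section \<open>Gradient inequalities for convex and for Lipschitz-smooth functions\<close>

lemma has_real_derivative_along_line:
  fixes f :: "'a::real_inner \<Rightarrow> real"
  assumes "\<And>z. (f has_derivative (\<lambda>h. g z \<bullet> h)) (at z)"
  shows "((\<lambda>s. f (a + s *\<^sub>R h)) has_real_derivative g (a + s *\<^sub>R h) \<bullet> h) (at s within S)"
proof -
  have "((\<lambda>s. a + s *\<^sub>R h) has_derivative (\<lambda>d. d *\<^sub>R h)) (at s within S)"
    by (auto intro!: derivative_eq_intros)
  from has_derivative_compose[OF this assms]
  show ?thesis
    by (simp add: has_field_derivative_def mult.commute[of _ "g (a + s *\<^sub>R h) \<bullet> h"])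
qed

text \<open>Restricted to the line through \<open>a\<close> and \<open>y\<close>, \<open>f\<close>
  becomes a convex function of one real variable, which lies above its tangent at 0.\<close>

lemma convex_above_gradient:
  fixes f :: "'a::real_inner \<Rightarrow> real"
  assumes "convex_on UNIV f" and "\<And>z. (f has_derivative (\<lambda>h. g z \<bullet> h)) (at z)"
  shows "f a + g a \<bullet> (y - a) \<le> f y"
proof -
  let ?\<phi> = "\<lambda>s::real. f (a + s *\<^sub>R (y - a))"
  have "convex_on UNIV ?\<phi>"
  proof (rule convex_onI)
    fix s r t :: real assume t: "0 < t" "t < 1"
    have "a + ((1 - t) *\<^sub>R s + t *\<^sub>R r) *\<^sub>R (y - a)
        = (1 - t) *\<^sub>R (a + s *\<^sub>R (y - a)) + t *\<^sub>R (a + r *\<^sub>R (y - a))"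
      by (simp add: algebra_simps)
    then show "?\<phi> ((1 - t) *\<^sub>R s + t *\<^sub>R r) \<le> (1 - t) * ?\<phi> s + t * ?\<phi> r"
      using convex_onD[OF assms(1), of t "a + s *\<^sub>R (y - a)" "a + r *\<^sub>R (y - a)"] t by simp
  qed simp
  then have "?\<phi> 1 - ?\<phi> 0 \<ge> g (a + 0 *\<^sub>R (y - a)) \<bullet> (y - a) * (1 - 0)"
    by (rule convex_on_imp_above_tangent[OF _ _ _ _ has_real_derivative_along_line[OF assms(2)]])
      auto
  then show ?thesis by simp
qed

text \<open>Along the segment from \<open>a\<close> to \<open>y\<close>, \<open>f\<close> minus its
  quadratic upper model has nonpositive derivative, by Cauchy-Schwarz and the Lipschitz
  bound.\<close>

lemma lipschitz_gradient_descent: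
  fixes f :: "'a::real_inner \<Rightarrow> real"
  assumes "\<And>z. (f has_derivative (\<lambda>h. g z \<bullet> h)) (at z)" and "L-lipschitz_on UNIV g"
  shows "f y \<le> f a + g a \<bullet> (y - a) + L / 2 * (norm (y - a))\<^sup>2"
proof -
  define h where "h = y - a"
  let ?\<phi> = "\<lambda>s::real. f (a + s *\<^sub>R h) - s * (g a \<bullet> h) - L / 2 * s\<^sup>2 * (norm h)\<^sup>2"
  have "?\<phi> 1 \<le> ?\<phi> 0"
  proof (rule DERIV_nonpos_imp_nonincreasing[of 0 1 ?\<phi>])
    fix s :: real assume s: "0 \<le> s" "s \<le> 1"
    let ?D = "g (a + s *\<^sub>R h) \<bullet> h - g a \<bullet> h - L * s * (norm h)\<^sup>2"
    have "(?\<phi> has_real_derivative ?D) (at s)"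
      by (auto intro!: derivative_eq_intros has_real_derivative_along_line[OF assms(1)])
    moreover have "?D \<le> 0"
    proof -
      have "g (a + s *\<^sub>R h) \<bullet> h - g a \<bullet> h \<le> norm (g (a + s *\<^sub>R h) - g a) * norm h"
        using norm_cauchy_schwarz by (simp flip: inner_diff_left)
      also have "\<dots> \<le> (L * (s * norm h)) * norm h"
        using lipschitz_onD[OF assms(2), of "a + s *\<^sub>R h" a] s
        by (intro mult_right_mono) (auto simp: dist_norm)
      finally show ?thesis by (simp add: power2_eq_square)
    qed
    ultimately show "\<exists>y. (?\<phi> has_real_derivative y) (at s) \<and> y \<le> 0" by blast
  qed simp
  then show ?thesis by (simp add: h_def)
qed

section \<open>Averaging recursions with non-summable weights\<close>

text \<open>Once \<open>\<epsilon>\<close> is below half of the tolerance, the excess of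
  \<open>a\<close> over that half shrinks by factors \<open>1 - s k\<close>, each at most
  \<open>exp (- s k)\<close>. Divergence of the sum of the weights drives the product of these
  factors to 0.\<close>

lemma averaging_le_tendsto_0:
  fixes a s \<epsilon> :: "nat \<Rightarrow> real"
  assumes nonneg: "\<And>k. 0 \<le> a k"
    and s: "\<And>k. 0 \<le> s k" "\<And>k. s k \<le> 1" "\<not> summable s"
    and \<epsilon>: "\<epsilon> \<longlonglongrightarrow> 0"
    and step: "\<And>k. a (Suc k) \<le> (1 - s k) * a k + s k * \<epsilon> k"
  shows "a \<longlonglongrightarrow> 0"
proof (rule LIMSEQ_I)
  fix e :: real assume e: "0 < e"
  obtain N where N: "\<And>k. k \<ge> N \<Longrightarrow> \<epsilon> k \<le> e / 2"
    using order_tendstoD(2)[OF \<epsilon>, of "e / 2"] e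
    unfolding eventually_sequentially by (meson half_gt_zero less_imp_le)
  define d where "d k = max 0 (a (k + N) - e / 2)" for k
  define S where "S n = (\<Sum>i<n. s (i + N))" for n
  have d_step: "d (Suc k) \<le> (1 - s (k + N)) * d k" for k
  proof -
    have "a (Suc k + N) - e / 2
        \<le> (1 - s (k + N)) * a (k + N) + s (k + N) * \<epsilon> (k + N) - e / 2"
      using step[of "k + N"] by simp
    also have "\<dots> \<le> (1 - s (k + N)) * a (k + N) + s (k + N) * (e / 2) - e / 2"
      using mult_left_mono[OF N s(1), of "k + N" "k + N"] by simp
    also have "\<dots> = (1 - s (k + N)) * (a (k + N) - e / 2)" by (simp add: algebra_simps)
    also have "\<dots> \<le> (1 - s (k + N)) * d k"
      unfolding d_def using s by (intro mult_left_mono) auto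
    finally show ?thesis using s by (simp add: d_def)
  qed
  have d_exp: "d n \<le> exp (- S n) * d 0" for n
  proof (induction n)
    case 0
    then show ?case by (simp add: S_def)
  next
    case (Suc n)
    have "d (Suc n) \<le> (1 - s (n + N)) * d n" by (rule d_step)
    also have "\<dots> \<le> exp (- s (n + N)) * d n"
      using exp_ge_add_one_self[of "- s (n + N)"]
      by (intro mult_right_mono) (auto simp: d_def)
    also have "\<dots> \<le> exp (- s (n + N)) * (exp (- S n) * d 0)"
      using Suc by (intro mult_left_mono) auto
    also have "\<dots> = exp (- S (Suc n)) * d 0"
      by (simp add: S_def exp_add[symmetric] flip: mult.assoc)
    finally show ?case .
  qed
  obtain m where m: "exp (- S m) * d 0 < e / 2"
  proof -
    \<comment> \<open>\<open>M\<close> is chosen to make \<open>exp (- M) * d 0\<close> smaller than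
      \<open>e / 2\<close>; the added 1 keeps the argument of \<open>ln\<close> positive when
      \<open>d 0\<close> vanishes.\<close>
    define M where "M = ln (2 * (d 0 + 1) / e)"
    have "\<exists>m. S m > M"
    proof (rule ccontr)
      assume "\<not> ?thesis"
      then have "summable (\<lambda>i. s (i + N))"
        by (intro summableI_nonneg_bounded[of _ M]) (auto simp: s S_def not_less)
      then show False using s(3) by (simp add: summable_iff_shift)
    qed
    then obtain m where "S m > M" by blast
    have d0: "0 \<le> d 0" by (simp add: d_def)
    have "exp (- S m) * d 0 \<le> exp (- M) * d 0"
      using \<open>S m > M\<close> d0 by (intro mult_right_mono) auto
    also have "\<dots> = d 0 * e / (2 * (d 0 + 1))"
      using d0 e by (simp add: M_def exp_minus)
    also have "\<dots> < e / 2"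
      using d0 e by (simp add: field_simps)
    finally show ?thesis by (rule that)
  qed
  have d_dec: "d n \<le> d m" if "m \<le> n" for n
    using that
  proof (induction rule: dec_induct)
    case (step n)
    have "(1 - s (n + N)) * d n \<le> 1 * d n"
      using s by (intro mult_right_mono) (auto simp: d_def)
    then show ?case using d_step[of n] step by simp
  qed simp
  have "norm (a n - 0) < e" if "m + N \<le> n" for n
  proof -
    have "d (n - N) < e / 2"
      using d_dec[of "n - N"] d_exp[of m] m that by linarith
    then show ?thesis using that nonneg[of n] e by (simp add: d_def max_def split: if_splits)
  qed
  then show "\<exists>no. \<forall>n\<ge>no. norm (a n - 0) < e" by blast
qed

text \<open>The increments of \<open>B\<close> need not be summable against \<open>1 / \<tau>\<^sup>2\<close>, but subtracting
  \<open>B k / (\<tau> k)\<^sup>2\<close> from \<open>h k\<close> turns them into a perturbation of relative size \<open>O(1 / (\<tau> k)\<^sup>2)\<close>.\<close>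
lemma averaging_bounded_increments_tendsto_0:
  fixes h \<psi> B :: "nat \<Rightarrow> 'a::real_normed_vector" and \<tau> :: "nat \<Rightarrow> real"
  assumes \<tau>: "\<And>k. 1 \<le> \<tau> k" "\<And>k. \<tau> k \<le> \<tau> (Suc k)"
      "\<And>k. (\<tau> (Suc k))\<^sup>2 - (\<tau> k)\<^sup>2 \<le> \<eta> * \<tau> (Suc k)" "filterlim \<tau> at_top sequentially"
    and \<eta>: "0 < \<eta>" "\<eta> \<le> 1" and div: "\<not> summable (\<lambda>k. \<eta> / \<tau> (Suc k))"
    and B: "\<And>k. norm (B k) \<le> C" and \<psi>: "\<psi> \<longlonglongrightarrow> 0"
    and step: "\<And>k. h (Suc k) = (1 - \<eta> / \<tau> (Suc k)) *\<^sub>R h k + (\<eta> / \<tau> (Suc k)) *\<^sub>R \<psi> k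
        + (1 / (\<tau> (Suc k))\<^sup>2) *\<^sub>R (B (Suc k) - B k)"
  shows "h \<longlonglongrightarrow> 0"
proof -
  have pos: "0 < \<tau> k" for k using \<tau>(1)[of k] by linarith
  have inv: "(\<lambda>k. 1 / (\<tau> k)\<^sup>2) \<longlonglongrightarrow> 0"
  proof -
    have "(\<lambda>k. inverse (\<tau> k)) \<longlonglongrightarrow> 0"
      using tendsto_inverse_0_at_top[OF \<tau>(4)] .
    from tendsto_power[OF this, of 2] show ?thesis by (simp add: field_simps)
  qed
  have B_lim: "(\<lambda>k. (1 / (\<tau> k)\<^sup>2) *\<^sub>R B k) \<longlonglongrightarrow> 0"
    by (rule Lim_null_comparison[OF _ tendsto_mult_right_zero[OF inv, of C]])
      (auto intro!: always_eventually divide_right_mono B)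
  define g where "g k = h k - (1 / (\<tau> k)\<^sup>2) *\<^sub>R B k" for k
  have "(\<lambda>k. norm (g k)) \<longlonglongrightarrow> 0"
  proof (rule averaging_le_tendsto_0[OF _ _ _ div])
    show "(\<lambda>k. norm (\<psi> k) + C * (1 / (\<tau> k)\<^sup>2)) \<longlonglongrightarrow> 0"
      using tendsto_add[OF tendsto_norm_zero[OF \<psi>] tendsto_mult_right_zero[OF inv, of C]] by simp
    fix k
    let ?s = "\<eta> / \<tau> (Suc k)"
    show s: "0 \<le> ?s" "?s \<le> 1" using pos[of "Suc k"] \<eta> \<tau>(1)[of "Suc k"] by auto
    \<comment> \<open>When \<open>h\<close> is expressed through \<open>g\<close>, the coefficient
      left on \<open>B k\<close> is \<open>- \<theta>\<close>. The rate condition makes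
      \<open>\<theta>\<close> nonnegative, and monotonicity of \<open>\<tau>\<close> bounds it by
      the weight \<open>?s\<close> times \<open>1 / (\<tau> k)\<^sup>2\<close>.\<close>
    define \<theta> where "\<theta> = (\<eta> * \<tau> (Suc k) - ((\<tau> (Suc k))\<^sup>2 - (\<tau> k)\<^sup>2)) / ((\<tau> k)\<^sup>2 * (\<tau> (Suc k))\<^sup>2)"
    have coeff: "(1 - ?s) * (1 / (\<tau> k)\<^sup>2) - 1 / (\<tau> (Suc k))\<^sup>2 = - \<theta>"
      unfolding \<theta>_def using pos[of k] pos[of "Suc k"] by (simp add: field_simps power2_eq_square)
    have \<theta>0: "0 \<le> \<theta>"
      unfolding \<theta>_def using \<tau>(3)[of k] by simp
    have "\<theta> \<le> (\<eta> * \<tau> (Suc k)) / ((\<tau> k)\<^sup>2 * (\<tau> (Suc k))\<^sup>2)"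
      unfolding \<theta>_def using \<tau>(2)[of k] pos[of k] by (intro divide_right_mono) (auto simp: power_mono)
    also have "\<dots> = ?s * (1 / (\<tau> k)\<^sup>2)"
      using pos[of k] pos[of "Suc k"] by (simp add: field_simps power2_eq_square)
    finally have \<theta>1: "\<theta> \<le> ?s * (1 / (\<tau> k)\<^sup>2)" .
    have "g (Suc k) = (1 - ?s) *\<^sub>R h k + ?s *\<^sub>R \<psi> k - (1 / (\<tau> (Suc k))\<^sup>2) *\<^sub>R B k"
      by (simp add: g_def step scaleR_diff_right)
    also have "\<dots> = (1 - ?s) *\<^sub>R g k + ?s *\<^sub>R \<psi> k
        + ((1 - ?s) * (1 / (\<tau> k)\<^sup>2) - 1 / (\<tau> (Suc k))\<^sup>2) *\<^sub>R B k"
      unfolding g_def scaleR_diff_right scaleR_diff_left scaleR_scaleR by simp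
    also have "\<dots> = (1 - ?s) *\<^sub>R g k + ?s *\<^sub>R \<psi> k + (- \<theta>) *\<^sub>R B k"
      by (simp only: coeff)
    also have "norm \<dots> \<le> (1 - ?s) * norm (g k) + ?s * norm (\<psi> k) + \<theta> * norm (B k)"
      using s \<theta>0 by (intro order.trans[OF norm_triangle_ineq] add_mono)
        (simp_all only: norm_scaleR abs_minus_cancel abs_of_nonneg diff_ge_0_iff_ge order_refl)
    also have "\<dots> \<le> (1 - ?s) * norm (g k) + ?s * norm (\<psi> k) + (?s * (1 / (\<tau> k)\<^sup>2)) * C"
      using s \<theta>0 \<theta>1 B[of k] by (intro add_mono mult_mono) (auto intro: order.trans)
    finally show "norm (g (Suc k)) \<le> (1 - ?s) * norm (g k) + ?s * (norm (\<psi> k) + C * (1 / (\<tau> k)\<^sup>2))"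
      by (simp add: algebra_simps)
  qed simp
  then have "g \<longlonglongrightarrow> 0" by (rule tendsto_norm_zero_cancel)
  from tendsto_add[OF this B_lim] show ?thesis by (simp add: g_def)
qed

text \<open>Otherwise some subsequence keeps \<open>F\<close> away from \<open>c\<close>; by
  compactness it has a convergent further subsequence, and continuity contradicts the assumption on
  its limit.\<close>

lemma tendsto_of_cluster_values:
  fixes z :: "nat \<Rightarrow> 'a::heine_borel" and F :: "'a \<Rightarrow> 'b::metric_space"
  assumes bdd: "bounded (range z)" and cont: "continuous_on UNIV F"
    and cluster: "\<And>r w. strict_mono r \<Longrightarrow> (z \<circ> r) \<longlonglongrightarrow> w \<Longrightarrow> F w = c"
  shows "(\<lambda>k. F (z k)) \<longlonglongrightarrow> c"
proof (rule ccontr)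
  assume "\<not> ?thesis"
  then obtain e where e: "0 < e" "\<And>N. \<exists>n\<ge>N. e \<le> dist (F (z n)) c"
    unfolding lim_sequentially by (auto simp: not_less)
  then have "infinite {n. e \<le> dist (F (z n)) c}"
    unfolding infinite_nat_iff_unbounded_le by blast
  then obtain r :: "nat \<Rightarrow> nat" where r: "strict_mono r" "\<And>n. e \<le> dist (F (z (r n))) c"
    using infinite_enumerate by (metis mem_Collect_eq)
  have "bounded (range (z \<circ> r))"
    by (rule bounded_subset[OF bdd]) auto
  then obtain w r' where r': "strict_mono (r' :: nat \<Rightarrow> nat)" "((z \<circ> r) \<circ> r') \<longlonglongrightarrow> w"
    using bounded_imp_convergent_subsequence by blast
  have "F w = c"
    using cluster[of "r \<circ> r'" w] r(1) r' by (simp add: strict_mono_o o_assoc)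
  moreover have "(\<lambda>k. F (((z \<circ> r) \<circ> r') k)) \<longlonglongrightarrow> F w"
    using continuous_on_tendsto_compose[OF cont r'(2)] by simp
  ultimately have "(\<lambda>k. dist (F (z (r (r' k)))) c) \<longlonglongrightarrow> 0"
    using tendsto_dist[OF _ tendsto_const[of c]] by fastforce
  then have "\<forall>\<^sub>F k in sequentially. dist (F (z (r (r' k)))) c < e"
    using e(1) order_tendstoD(2) by blast
  then show False using r(2) by (auto simp: eventually_sequentially not_less[symmetric])
qed

section \<open>Inertial primal-dual iterations\<close>

text \<open>With \<open>\<tau> k\<close> in the role of the parameter of index \<open>Suc k\<close>,
  this is the extrapolated point used by iteration \<open>Suc k\<close>.\<close>

definition inertial :: "(nat \<Rightarrow> real) \<Rightarrow> (nat \<Rightarrow> 'a::real_vector) \<Rightarrow> nat \<Rightarrow> 'a" where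
  "inertial \<tau> z k = z (Suc k) + ((\<tau> k - 1) / \<tau> (Suc k)) *\<^sub>R (z (Suc k) - z k)"

text \<open>The combination \<open>c\<close> times the new iterate minus \<open>\<alpha>\<close>
  times the old one, where \<open>c - \<alpha> = 1\<close>. The dual step measures feasibility
  there, and the primal step uses it as multiplier.\<close>

definition overshoot :: "real \<Rightarrow> (nat \<Rightarrow> real) \<Rightarrow> (nat \<Rightarrow> 'a::real_vector) \<Rightarrow> nat \<Rightarrow> 'a" where
  "overshoot \<eta> \<tau> z k = z (Suc k) + (\<tau> (Suc k) / \<eta>) *\<^sub>R (z (Suc (Suc k)) - z (Suc k))"

definition anchored :: "real \<Rightarrow> (nat \<Rightarrow> real) \<Rightarrow> (nat \<Rightarrow> 'a::real_vector) \<Rightarrow> 'a \<Rightarrow> nat \<Rightarrow> 'a" where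
  "anchored \<eta> \<tau> z p k = \<eta> *\<^sub>R (z (Suc k) - p) + (\<tau> k - 1) *\<^sub>R (z (Suc k) - z k)"

text \<open>The weight \<open>\<eta> * (1 - \<eta>)\<close> is the one that cancels the inner
  product of \<open>z (Suc (Suc k)) - p\<close> with the latest displacement when consecutive
  energies are subtracted.\<close>

definition inertial_energy ::
  "real \<Rightarrow> (nat \<Rightarrow> real) \<Rightarrow> (nat \<Rightarrow> 'a::real_inner) \<Rightarrow> 'a \<Rightarrow> nat \<Rightarrow> real" where
  "inertial_energy \<eta> \<tau> z p k =
     (norm (anchored \<eta> \<tau> z p k))\<^sup>2 + \<eta> * (1 - \<eta>) * (norm (z (Suc k) - p))\<^sup>2"

lemma anchored_increment:
  assumes "\<tau> (Suc k) \<noteq> 0"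
  shows "anchored \<eta> \<tau> z p (Suc k) - anchored \<eta> \<tau> z p k =
    \<tau> (Suc k) *\<^sub>R (z (Suc (Suc k)) - inertial \<tau> z k) - (1 - \<eta>) *\<^sub>R (z (Suc (Suc k)) - z (Suc k))"
proof -
  have "\<tau> (Suc k) *\<^sub>R inertial \<tau> z k = \<tau> (Suc k) *\<^sub>R z (Suc k) + (\<tau> k - 1) *\<^sub>R (z (Suc k) - z k)"
    using assms by (simp add: inertial_def scaleR_add_right)
  then show ?thesis
    by (simp add: anchored_def scaleR_diff_right scaleR_diff_left)
qed

lemma overshoot_diff:
  assumes "\<eta> \<noteq> 0"
  shows "\<eta> *\<^sub>R (overshoot \<eta> \<tau> z k - p) =
    \<eta> *\<^sub>R (z (Suc (Suc k)) - p) + (\<tau> (Suc k) - \<eta>) *\<^sub>R (z (Suc (Suc k)) - z (Suc k))"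
  using assms by (simp add: overshoot_def scaleR_diff_right scaleR_diff_left scaleR_add_right)

text \<open>The old anchored vector is the new one minus
  \<open>e - (1 - \<eta>) *\<^sub>R d\<close>. On expanding the squares, the products with
  \<open>e\<close> combine into the overshoot, the products of \<open>y\<close> and \<open>d\<close>
  cancel, and a multiple of the square of \<open>d\<close> remains.\<close>

lemma inertial_energy_increment:
  fixes z :: "nat \<Rightarrow> 'a::real_inner"
  assumes "\<eta> \<noteq> 0" "\<tau> (Suc k) \<noteq> 0"
  defines "e \<equiv> \<tau> (Suc k) *\<^sub>R (z (Suc (Suc k)) - inertial \<tau> z k)"
  shows "inertial_energy \<eta> \<tau> z p (Suc k) - inertial_energy \<eta> \<tau> z p k =
    2 * \<eta> * ((overshoot \<eta> \<tau> z k - p) \<bullet> e) - (norm e)\<^sup>2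
    - (1 - \<eta>) * (2 * \<tau> (Suc k) - 1) * (norm (z (Suc (Suc k)) - z (Suc k)))\<^sup>2"
proof -
  define d where "d = z (Suc (Suc k)) - z (Suc k)"
  define y where "y = z (Suc (Suc k)) - p"
  define u where "u = \<eta> *\<^sub>R y + (\<tau> (Suc k) - 1) *\<^sub>R d"
  have u': "anchored \<eta> \<tau> z p (Suc k) = u"
    by (simp add: anchored_def u_def y_def d_def)
  have u: "anchored \<eta> \<tau> z p k = u - (e - (1 - \<eta>) *\<^sub>R d)"
    using anchored_increment[of \<tau> k \<eta> z p] assms(2) u' unfolding e_def d_def
    by (simp add: algebra_simps)
  have z: "z (Suc k) - p = y - d" by (simp add: y_def d_def)
  have o: "\<eta> * ((overshoot \<eta> \<tau> z k - p) \<bullet> e) = (\<eta> *\<^sub>R y + (\<tau> (Suc k) - \<eta>) *\<^sub>R d) \<bullet> e"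
    using overshoot_diff[OF assms(1), of \<tau> z k p] unfolding y_def d_def
    by (simp flip: inner_scaleR_left)
  show ?thesis
    unfolding inertial_energy_def u' u z mult.assoc o d_def[symmetric] y_def[symmetric]
    unfolding u_def power2_norm_eq_inner
    by (simp add: inner_add_left inner_add_right inner_diff_left inner_diff_right
        inner_commute[of d y] inner_commute[of e y] inner_commute[of e d] algebra_simps)
qed

text \<open>The next \<open>z - p\<close> is a convex combination of the previous one and the
  anchored vector divided by \<open>\<eta>\<close>, so the ball of radius \<open>C / \<eta>\<close>
  is never left. The start uses \<open>\<tau> 0 = 1\<close>, which removes the displacement
  term.\<close>

lemma anchored_bounded_imp_bounded:
  fixes z :: "nat \<Rightarrow> 'a::real_normed_vector"
  assumes \<tau>: "\<tau> 0 = 1" "\<And>k. 1 \<le> \<tau> k" and \<eta>: "0 < \<eta>"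
    and C: "\<And>k. norm (anchored \<eta> \<tau> z p k) \<le> C"
  shows "norm (z (Suc k) - p) \<le> C / \<eta>"
proof (induction k)
  case 0
  show ?case using C[of 0] \<tau>(1) \<eta> by (simp add: anchored_def pos_le_divide_eq mult.commute)
next
  case (Suc k)
  let ?t = "\<tau> (Suc k)"
  have "(?t - 1 + \<eta>) *\<^sub>R (z (Suc (Suc k)) - p)
      = anchored \<eta> \<tau> z p (Suc k) + (?t - 1) *\<^sub>R (z (Suc k) - p)"
    by (simp add: anchored_def algebra_simps)
  then have "(?t - 1 + \<eta>) * norm (z (Suc (Suc k)) - p)
      = norm (anchored \<eta> \<tau> z p (Suc k) + (?t - 1) *\<^sub>R (z (Suc k) - p))"
    using \<tau>(2)[of "Suc k"] \<eta>
    by (metis abs_of_nonneg add_nonneg_nonneg diff_ge_0_iff_ge less_imp_le norm_scaleR)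
  also have "\<dots> \<le> C + (?t - 1) * (C / \<eta>)"
    using \<tau>(2)[of "Suc k"] C Suc
    by (intro order.trans[OF norm_triangle_ineq] add_mono) (auto intro: mult_left_mono simp del: times_divide_eq_right)
  also have "\<dots> = (?t - 1 + \<eta>) * (C / \<eta>)" using \<eta> by (simp add: field_simps)
  finally show ?case using \<tau>(2)[of "Suc k"] \<eta> by (simp del: times_divide_eq_right)
qed

text \<open>The index is shifted: \<open>\<tau> k\<close> is the parameter \<open>t\<^sub>k\<^sub>+\<^sub>1\<close>, so that no truncated subtraction occurs.
  The gradient is evaluated at \<open>q k\<close>, which is the new iterate in Case I and the extrapolated
  point in Case II.\<close>
locale inertial_primal_dual =
  fixes f :: "real^'n \<Rightarrow> real" and grad_f :: "real^'n \<Rightarrow> real^'n"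
    and A :: "real^'n^'m" and b :: "real^'m"
    and \<tau> :: "nat \<Rightarrow> real" and \<eta> \<gamma> \<delta> \<beta> :: real
    and x :: "nat \<Rightarrow> real^'n" and l :: "nat \<Rightarrow> real^'m" and q :: "nat \<Rightarrow> real^'n"
  assumes f_convex: "convex_on UNIV f"
    and f_grad: "\<And>z. (f has_derivative (\<lambda>h. grad_f z \<bullet> h)) (at z)"
    and grad_cont: "continuous_on UNIV grad_f"
    and \<tau>_0: "\<tau> 0 = 1"
    and \<tau>_mono: "\<And>k. \<tau> k \<le> \<tau> (Suc k)"
    and \<tau>_rate: "\<And>k. (\<tau> (Suc k))\<^sup>2 - (\<tau> k)\<^sup>2 \<le> \<eta> * \<tau> (Suc k)"
    and \<tau>_lim: "filterlim \<tau> at_top sequentially"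
    and \<eta>_pos: "0 < \<eta>" and \<eta>_le1: "\<eta> \<le> 1"
    and \<gamma>_pos: "0 < \<gamma>" and \<delta>_pos: "0 < \<delta>" and \<beta>_nonneg: "0 \<le> \<beta>"
    and primal_step: "\<And>k. x (Suc (Suc k)) - inertial \<tau> x k =
        - \<gamma> *\<^sub>R (grad_f (q k) + \<beta> *\<^sub>R (transpose A *v (A *v x (Suc (Suc k)) - b))
                + transpose A *v overshoot \<eta> \<tau> l k)"
    and dual_step: "\<And>k. l (Suc (Suc k)) - inertial \<tau> l k = \<delta> *\<^sub>R (A *v overshoot \<eta> \<tau> x k - b)"
    and grad_ineq: "\<And>k y. f (x (Suc (Suc k))) - f y
          - 1 / (2 * \<gamma>) * (norm (x (Suc (Suc k)) - inertial \<tau> x k))\<^sup>2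
        \<le> grad_f (q k) \<bullet> (x (Suc (Suc k)) - y)"
    and q_near: "\<And>k. norm (q k - x (Suc (Suc k))) \<le> norm (x (Suc (Suc k)) - inertial \<tau> x k)"
begin

section \<open>Growth of the extrapolation parameters\<close>

lemma \<tau>_ge_1: "1 \<le> \<tau> k"
  using lift_Suc_mono_le[of \<tau> 0 k] \<tau>_mono \<tau>_0 by simp

lemma \<tau>_pos: "0 < \<tau> k"
  using \<tau>_ge_1[of k] by linarith

text \<open>Factoring the difference of squares in the rate condition bounds each increment of
  \<open>\<tau>\<close> by \<open>\<eta>\<close>, hence by 1.\<close>

lemma \<tau>_le_linear: "\<tau> k \<le> real (Suc k)"
proof (induction k)
  case (Suc k)
  have "(\<tau> (Suc k) - \<tau> k) * \<tau> (Suc k) \<le> (\<tau> (Suc k) - \<tau> k) * (\<tau> (Suc k) + \<tau> k)"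
    using \<tau>_mono[of k] \<tau>_pos[of k] by (intro mult_left_mono) auto
  also have "\<dots> \<le> \<eta> * \<tau> (Suc k)"
    using \<tau>_rate[of k] by (simp add: power2_eq_square algebra_simps)
  finally have "\<tau> (Suc k) - \<tau> k \<le> \<eta>" using \<tau>_pos[of "Suc k"] by simp
  then show ?case using Suc \<eta>_le1 by simp
qed (simp add: \<tau>_0)

text \<open>Linear growth of \<open>\<tau>\<close> allows comparison with the harmonic
  series.\<close>

lemma not_summable_inverse_\<tau>: "\<not> summable (\<lambda>k. 1 / \<tau> k)"
proof
  assume "summable (\<lambda>k. 1 / \<tau> k)"
  then have "summable (\<lambda>k. inverse (real (Suc k)))"
    by (rule summable_comparison_test')
      (use \<tau>_le_linear \<tau>_pos in \<open>auto simp: divide_inverse intro!: le_imp_inverse_le\<close>)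
  then show False using not_summable_harmonic[where 'a=real] by (subst (asm) summable_Suc_iff) simp
qed

lemma not_summable_\<eta>_\<tau>: "\<not> summable (\<lambda>k. \<eta> / \<tau> (Suc k))"
proof
  assume "summable (\<lambda>k. \<eta> / \<tau> (Suc k))"
  from summable_mult[OF this, of "1 / \<eta>"] have "summable (\<lambda>k. 1 / \<tau> (Suc k))"
    using \<eta>_pos by simp
  then show False using not_summable_inverse_\<tau> summable_Suc_iff[of "\<lambda>k. 1 / \<tau> k"] by simp
qed

lemma inertial_energy_nonneg: "0 \<le> inertial_energy \<eta> \<tau> z p k"
  using \<eta>_pos \<eta>_le1 by (simp add: inertial_energy_def)

lemma norm_anchored_le: "(norm (anchored \<eta> \<tau> z p k))\<^sup>2 \<le> inertial_energy \<eta> \<tau> z p k"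
  using \<eta>_pos \<eta>_le1 by (simp add: inertial_energy_def)

lemma inverse_\<tau>_tendsto_0: "(\<lambda>k. inverse (\<tau> k)) \<longlonglongrightarrow> 0"
  by (rule tendsto_inverse_0_at_top[OF \<tau>_lim])

section \<open>The augmented Lagrangian and the decreasing energy\<close>

definition lagr :: "real^'m \<Rightarrow> real^'n \<Rightarrow> real" where
  "lagr ls y = f y + \<beta> / 2 * (norm (A *v y - b))\<^sup>2 + ls \<bullet> (A *v y - b)"

definition energy :: "real^'n \<Rightarrow> real^'m \<Rightarrow> nat \<Rightarrow> real" where
  "energy xs ls k = 2 * (\<tau> k)\<^sup>2 * (lagr ls (x (Suc k)) - lagr ls xs)
     + inertial_energy \<eta> \<tau> x xs k / \<gamma> + inertial_energy \<eta> \<tau> l ls k / \<delta>"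

text \<open>The convexity inequality of the quadratic penalty at the new iterate is added to
  \<open>grad_ineq\<close>; the multiplier term is affine and contributes an equality.\<close>

lemma lagr_step:
  "lagr ls (x (Suc (Suc k))) - lagr ls y
      - 1 / (2 * \<gamma>) * (norm (x (Suc (Suc k)) - inertial \<tau> x k))\<^sup>2
    \<le> (grad_f (q k) + \<beta> *\<^sub>R (transpose A *v (A *v x (Suc (Suc k)) - b)) + transpose A *v ls)
        \<bullet> (x (Suc (Suc k)) - y)"
proof -
  define g where "g = A *v x (Suc (Suc k)) - b"
  define g' where "g' = A *v y - b"
  have gg: "A *v (x (Suc (Suc k)) - y) = g - g'"
    by (simp add: g_def g'_def matrix_vector_mult_diff_distrib)
  have "0 \<le> (norm (g - g'))\<^sup>2" by simp
  then have "(norm g)\<^sup>2 / 2 - (norm g')\<^sup>2 / 2 \<le> g \<bullet> (g - g')"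
    unfolding power2_norm_eq_inner
    by (simp add: inner_diff_left inner_diff_right inner_commute[of g' g])
  from mult_left_mono[OF this \<beta>_nonneg]
  have "\<beta> / 2 * (norm g)\<^sup>2 - \<beta> / 2 * (norm g')\<^sup>2 \<le> \<beta> * (g \<bullet> (g - g'))"
    by (simp add: algebra_simps)
  then show ?thesis
    using grad_ineq[of k y]
    unfolding lagr_def inner_add_left inner_scaleR_left inner_transpose_left gg
      g_def[symmetric] g'_def[symmetric]
    by (simp add: inner_diff_right)
qed

context
  fixes xs :: "real^'n" and ls :: "real^'m"
  assumes kkt: "(xs, ls) \<in> kkt_set A b grad_f"
begin

lemma kkt_feasible: "A *v xs = b"
  and kkt_stationary: "grad_f xs = - (transpose A *v ls)"
  using kkt by (auto simp: kkt_set_def eq_neg_iff_add_eq_0)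

lemma lagr_anchor: "lagr ls xs = f xs"
  by (simp add: lagr_def kkt_feasible)

text \<open>Stationarity identifies the slope of the tangent plane of \<open>f\<close> at
  \<open>xs\<close> with minus the slope of the multiplier term.\<close>

lemma lagr_lower: "f xs \<le> f y + ls \<bullet> (A *v y - b)"
proof -
  have "grad_f xs \<bullet> (y - xs) = - (ls \<bullet> (A *v y - b))"
    by (simp only: kkt_stationary inner_minus_left inner_transpose_left
        matrix_vector_mult_diff_distrib kkt_feasible)
  then show ?thesis using convex_above_gradient[OF f_convex f_grad, of xs y] by simp
qed

lemma lagr_gap_nonneg: "0 \<le> lagr ls y - lagr ls xs"
proof -
  have "0 \<le> \<beta> / 2 * (norm (A *v y - b))\<^sup>2" using \<beta>_nonneg by simp
  then show ?thesis using lagr_lower[of y] unfolding lagr_anchor by (simp add: lagr_def)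
qed

text \<open>By \<open>lagr_lower\<close> such a \<open>w\<close> minimizes the unpenalized
  Lagrangian of \<open>ls\<close> over the whole space, so its derivative vanishes at
  \<open>w\<close>. This fixes the gradient at every solution.\<close>

lemma grad_eq_of_optimal:
  assumes "A *v w = b" "f w \<le> f xs"
  shows "grad_f w = - (transpose A *v ls)"
proof -
  have "((\<lambda>y. f y + ls \<bullet> (A *v y - b)) has_derivative
      (\<lambda>h. grad_f w \<bullet> h + ls \<bullet> (A *v h))) (at w)"
    by (auto intro!: derivative_eq_intros f_grad bounded_linear_imp_has_derivative
        matrix_vector_mul_bounded_linear)
  moreover have "\<forall>y\<in>UNIV. f w + ls \<bullet> (A *v w - b) \<le> f y + ls \<bullet> (A *v y - b)"
    using lagr_lower assms by (auto intro: order.trans)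
  ultimately have "(\<lambda>h. grad_f w \<bullet> h + ls \<bullet> (A *v h)) = (\<lambda>h. 0)"
    using differential_zero_maxmin[of w UNIV] by blast
  then have "(grad_f w + transpose A *v ls) \<bullet> h = 0" for h
    unfolding inner_add_left inner_transpose_left by meson
  then show ?thesis by (metis eq_neg_iff_add_eq_0 inner_eq_zero_iff)
qed

text \<open>After the bilinear terms cancel, the two inertial energies change by at most a multiple
  of \<open>v \<bullet> (\<xi> - xs)\<close> and a negative square. Convexity turns the former into
  Lagrangian gaps, and the rate condition matches their weights with those in the energy.\<close>

lemma energy_decreasing: "energy xs ls (Suc k) \<le> energy xs ls k"
proof -
  define X where "X = x (Suc (Suc k))"
  define e where "e = X - inertial \<tau> x k"
  define \<xi> where "\<xi> = overshoot \<eta> \<tau> x k"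
  define \<mu> where "\<mu> = overshoot \<eta> \<tau> l k"
  define T where "T = \<tau> (Suc k)"
  define v where "v = grad_f (q k) + \<beta> *\<^sub>R (transpose A *v (A *v X - b)) + transpose A *v ls"
  have T: "0 < T" "\<eta> \<le> T" using \<tau>_ge_1[of "Suc k"] \<eta>_le1 by (auto simp: T_def)
  have A\<xi>: "A *v \<xi> - b = A *v (\<xi> - xs)"
    by (simp add: matrix_vector_mult_diff_distrib kkt_feasible)
  have e_eq: "e = - \<gamma> *\<^sub>R (v + transpose A *v (\<mu> - ls))"
    unfolding e_def v_def \<mu>_def X_def primal_step
    by (simp add: matrix_vector_mult_diff_distrib del: transpose_matrix_vector)
  \<comment> \<open>Since \<open>A *v \<xi> - b = A *v (\<xi> - xs)\<close>, the multiplier part of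
    \<open>e\<close> paired with \<open>\<xi> - xs\<close> is the exact opposite of the dual
    pairing.\<close>
  have bil: "(\<xi> - xs) \<bullet> e / \<gamma> + (\<mu> - ls) \<bullet> (A *v \<xi> - b) = - (v \<bullet> (\<xi> - xs))"
    unfolding e_eq A\<xi> inner_commute[of "\<xi> - xs"] inner_scaleR_left inner_add_left inner_transpose_left
    using \<gamma>_pos by (simp add: field_simps)
  \<comment> \<open>This splitting lets the convexity inequality be used at \<open>xs\<close> and at
    the previous iterate, with the nonnegative weights \<open>\<eta>\<close> and
    \<open>T - \<eta>\<close>.\<close>
  have vx: "\<eta> * (v \<bullet> (\<xi> - xs)) = \<eta> * (v \<bullet> (X - xs)) + (T - \<eta>) * (v \<bullet> (X - x (Suc k)))"
    using overshoot_diff[of \<eta> \<tau> x k xs] \<eta>_pos unfolding \<xi>_def X_def T_def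
    by (simp flip: inner_scaleR_right inner_add_right)
  \<comment> \<open>The loss \<open>R\<close> in the convexity inequality is paid for exactly by the
    primal energy: the square of \<open>T *\<^sub>R e\<close> divided by \<open>\<gamma>\<close>
    equals \<open>2 * T\<^sup>2 * R\<close>.\<close>
  define R where "R = 1 / (2 * \<gamma>) * (norm e)\<^sup>2"
  define P where "P y = lagr ls y - lagr ls xs" for y
  have step: "P X - P y - R \<le> v \<bullet> (X - y)" for y
    using lagr_step[of ls k y] by (simp add: v_def X_def e_def R_def P_def)
  have "\<eta> * (P X - R) + (T - \<eta>) * (P X - P (x (Suc k)) - R) \<le> \<eta> * (v \<bullet> (\<xi> - xs))"
    unfolding vx using step[of xs] step[of "x (Suc k)"] T \<eta>_pos
    by (intro add_mono mult_left_mono) (auto simp: P_def)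
  then have "T * P X - (T - \<eta>) * P (x (Suc k)) - T * R \<le> \<eta> * (v \<bullet> (\<xi> - xs))"
    by (simp add: algebra_simps)
  from mult_left_mono[OF this, of "2 * T"] T(1)
  have main: "2 * T\<^sup>2 * P X - 2 * (T * (T - \<eta>)) * P (x (Suc k)) - 2 * T\<^sup>2 * R
      \<le> 2 * T * (\<eta> * (v \<bullet> (\<xi> - xs)))"
    by (simp add: algebra_simps power2_eq_square)
  have "T * (T - \<eta>) \<le> (\<tau> k)\<^sup>2"
    using \<tau>_rate[of k] by (simp add: T_def algebra_simps power2_eq_square)
  from mult_right_mono[OF this lagr_gap_nonneg[of "x (Suc k)"]]
  have rate: "(T * (T - \<eta>)) * P (x (Suc k)) \<le> (\<tau> k)\<^sup>2 * P (x (Suc k))" by (simp add: P_def)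
  have neg: "0 \<le> (1 - \<eta>) * (2 * T - 1) * (norm w)\<^sup>2" for w :: "'z::real_normed_vector"
    using \<eta>_le1 \<tau>_ge_1[of "Suc k"] by (simp add: T_def)
  have ne: "\<eta> \<noteq> 0" "\<tau> (Suc k) \<noteq> 0" using \<eta>_pos \<tau>_pos[of "Suc k"] by auto
  have "inertial_energy \<eta> \<tau> x xs (Suc k) - inertial_energy \<eta> \<tau> x xs k
      \<le> 2 * \<eta> * ((\<xi> - xs) \<bullet> (T *\<^sub>R e)) - (norm (T *\<^sub>R e))\<^sup>2"
    unfolding inertial_energy_increment[of \<eta> \<tau> k, OF ne] \<xi>_def e_def X_def T_def[symmetric]
    using neg[of "x (Suc (Suc k)) - x (Suc k)"] by simp
  from divide_right_mono[OF this, of \<gamma>]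
  have ex: "inertial_energy \<eta> \<tau> x xs (Suc k) / \<gamma> - inertial_energy \<eta> \<tau> x xs k / \<gamma>
      \<le> 2 * T * \<eta> * ((\<xi> - xs) \<bullet> e / \<gamma>) - 2 * T\<^sup>2 * R"
    using \<gamma>_pos by (simp add: R_def diff_divide_distrib power_mult_distrib mult_ac)
  have "inertial_energy \<eta> \<tau> l ls (Suc k) - inertial_energy \<eta> \<tau> l ls k
      \<le> 2 * \<eta> * ((\<mu> - ls) \<bullet> (T *\<^sub>R (\<delta> *\<^sub>R (A *v \<xi> - b))))"
    unfolding inertial_energy_increment[of \<eta> \<tau> k, OF ne] \<mu>_def \<xi>_def dual_step T_def[symmetric]
    using neg[of "l (Suc (Suc k)) - l (Suc k)"] zero_le_power2 by (smt (verit))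
  from divide_right_mono[OF this, of \<delta>]
  have el: "inertial_energy \<eta> \<tau> l ls (Suc k) / \<delta> - inertial_energy \<eta> \<tau> l ls k / \<delta>
      \<le> 2 * T * \<eta> * ((\<mu> - ls) \<bullet> (A *v \<xi> - b))"
    using \<delta>_pos by (simp add: diff_divide_distrib mult_ac)
  have "2 * T * \<eta> * ((\<xi> - xs) \<bullet> e / \<gamma>) + 2 * T * \<eta> * ((\<mu> - ls) \<bullet> (A *v \<xi> - b))
      = - (2 * T * (\<eta> * (v \<bullet> (\<xi> - xs))))"
    unfolding distrib_left[symmetric] bil by simp
  then show ?thesis
    using ex el main rate
    unfolding energy_def P_def T_def X_def by linarith
qed

lemma energy_le_initial: "energy xs ls k \<le> energy xs ls 0"
  using lift_Suc_antimono_le[of "energy xs ls" 0 k] energy_decreasing by simp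

lemma energy_components:
  shows "inertial_energy \<eta> \<tau> x xs k \<le> \<gamma> * energy xs ls 0"
    and "inertial_energy \<eta> \<tau> l ls k \<le> \<delta> * energy xs ls 0"
    and "2 * (\<tau> k)\<^sup>2 * (lagr ls (x (Suc k)) - lagr ls xs) \<le> energy xs ls 0"
    and "0 \<le> energy xs ls k"
proof -
  have 1: "0 \<le> 2 * (\<tau> k)\<^sup>2 * (lagr ls (x (Suc k)) - lagr ls xs)"
    using lagr_gap_nonneg[of "x (Suc k)"] by simp
  have 2: "0 \<le> inertial_energy \<eta> \<tau> x xs k / \<gamma>" "0 \<le> inertial_energy \<eta> \<tau> l ls k / \<delta>"
    using \<gamma>_pos \<delta>_pos by (auto intro!: divide_nonneg_pos inertial_energy_nonneg)
  note E = energy_le_initial[of k, unfolded energy_def[of xs ls k]]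
  have "inertial_energy \<eta> \<tau> x xs k / \<gamma> \<le> energy xs ls 0" using 1 2 E by linarith
  then show "inertial_energy \<eta> \<tau> x xs k \<le> \<gamma> * energy xs ls 0"
    using \<gamma>_pos by (simp add: pos_divide_le_eq mult.commute)
  have "inertial_energy \<eta> \<tau> l ls k / \<delta> \<le> energy xs ls 0" using 1 2 E by linarith
  then show "inertial_energy \<eta> \<tau> l ls k \<le> \<delta> * energy xs ls 0"
    using \<delta>_pos by (simp add: pos_divide_le_eq mult.commute)
  show "2 * (\<tau> k)\<^sup>2 * (lagr ls (x (Suc k)) - lagr ls xs) \<le> energy xs ls 0" using 2 E by linarith
  show "0 \<le> energy xs ls k" unfolding energy_def using 1 2 by linarith
qed

lemma convergent_energy: "convergent (energy xs ls)"
proof -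
  have "decseq (energy xs ls)" by (simp add: decseq_SucI energy_decreasing)
  moreover have "bdd_below (range (energy xs ls))"
    by (rule bdd_belowI[of _ 0]) (auto intro: energy_components(4))
  ultimately show ?thesis using LIMSEQ_decseq_INF convergentI by blast
qed

lemma norm_anchored_bound:
  shows "norm (anchored \<eta> \<tau> x xs k) \<le> sqrt (\<gamma> * energy xs ls 0)"
    and "norm (anchored \<eta> \<tau> l ls k) \<le> sqrt (\<delta> * energy xs ls 0)"
  by (intro real_le_rsqrt order.trans[OF norm_anchored_le] energy_components)+

text \<open>The energy bound forces the gap to decay at least as fast as a constant over
  \<open>(\<tau> k)\<^sup>2\<close>.\<close>

lemma lagr_gap_tendsto_0: "(\<lambda>k. lagr ls (x (Suc k)) - lagr ls xs) \<longlonglongrightarrow> 0"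
proof (rule tendsto_sandwich[OF _ _ tendsto_const])
  show "(\<lambda>k. energy xs ls 0 / 2 * (inverse (\<tau> k))\<^sup>2) \<longlonglongrightarrow> 0"
    using tendsto_mult[OF tendsto_const tendsto_power[OF inverse_\<tau>_tendsto_0, of 2], of "energy xs ls 0 / 2"]
    by simp
  show "\<forall>\<^sub>F k in sequentially. lagr ls (x (Suc k)) - lagr ls xs
      \<le> energy xs ls 0 / 2 * (inverse (\<tau> k))\<^sup>2"
    using energy_components(3) \<tau>_pos
    by (intro always_eventually allI) (simp add: field_simps less_imp_neq[symmetric])
qed (simp add: lagr_gap_nonneg del: diff_ge_0_iff_ge)

end

section \<open>Accumulated residuals and the averaging of linear images\<close>

text \<open>The added multiple of \<open>z (Suc k) - p\<close> removes the displacement from the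
  anchored increment, so that the increments of this bounded sequence are exactly the residuals
  scaled by \<open>\<tau>\<close>.\<close>

definition drift :: "(nat \<Rightarrow> 'v::real_normed_vector) \<Rightarrow> 'v \<Rightarrow> nat \<Rightarrow> 'v" where
  "drift z p k = anchored \<eta> \<tau> z p k + (1 - \<eta>) *\<^sub>R (z (Suc k) - p)"

lemma drift_increment:
  "drift z p (Suc k) - drift z p k = \<tau> (Suc k) *\<^sub>R (z (Suc (Suc k)) - inertial \<tau> z k)"
  using anchored_increment[of \<tau> k \<eta> z p] \<tau>_pos[of "Suc k"]
  by (simp add: drift_def algebra_simps)

lemma drift_bounded:
  assumes C: "\<And>k. norm (anchored \<eta> \<tau> z p k) \<le> C"
  shows "norm (drift z p k) \<le> C + (1 - \<eta>) * (C / \<eta>)"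
  unfolding drift_def
  using C[of k] anchored_bounded_imp_bounded[of \<tau> \<eta> z p C k, OF \<tau>_0 \<tau>_ge_1 \<eta>_pos C] \<eta>_le1
  by (intro order.trans[OF norm_triangle_ineq] add_mono)
    (auto simp del: times_divide_eq_right intro: mult_left_mono)

lemma bounded_of_anchored:
  assumes C: "\<And>k. norm (anchored \<eta> \<tau> z p k) \<le> C"
  shows "bounded (range z)"
proof -
  have "range z \<subseteq> insert (z 0) (cball p (C / \<eta>))"
  proof
    fix y assume "y \<in> range z"
    then obtain k where "y = z k" by blast
    then show "y \<in> insert (z 0) (cball p (C / \<eta>))"
      using anchored_bounded_imp_bounded[of \<tau> \<eta> z p C, OF \<tau>_0 \<tau>_ge_1 \<eta>_pos C]
      by (cases k) (auto simp: dist_norm norm_minus_commute)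
  qed
  then show ?thesis by (rule bounded_subset[rotated]) simp
qed

text \<open>The residual times \<open>\<tau> (Suc k)\<close> is an increment of the bounded drift,
  and \<open>\<tau>\<close> tends to infinity.\<close>

lemma inertial_residual_tendsto_0:
  assumes C: "\<And>k. norm (anchored \<eta> \<tau> z p k) \<le> C"
  shows "(\<lambda>k. z (Suc (Suc k)) - inertial \<tau> z k) \<longlonglongrightarrow> 0"
proof (rule Lim_null_comparison)
  define D where "D = C + (1 - \<eta>) * (C / \<eta>)"
  have "norm (z (Suc (Suc k)) - inertial \<tau> z k) \<le> (2 * D) * inverse (\<tau> (Suc k))" for k
  proof -
    have "\<tau> (Suc k) * norm (z (Suc (Suc k)) - inertial \<tau> z k) = norm (drift z p (Suc k) - drift z p k)"
      using \<tau>_pos[of "Suc k"] by (simp add: drift_increment)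
    also have "\<dots> \<le> D + D"
      unfolding D_def by (intro order.trans[OF norm_triangle_ineq4] add_mono drift_bounded C)
    finally show ?thesis using \<tau>_pos[of "Suc k"] by (simp add: field_simps)
  qed
  then show "\<forall>\<^sub>F k in sequentially. norm (z (Suc (Suc k)) - inertial \<tau> z k) \<le> (2 * D) * inverse (\<tau> (Suc k))"
    by simp
  show "(\<lambda>k. (2 * D) * inverse (\<tau> (Suc k))) \<longlonglongrightarrow> 0"
    by (intro tendsto_mult_right_zero LIMSEQ_Suc inverse_\<tau>_tendsto_0)
qed

text \<open>Expanding the overshoot into the new and the old iterate turns the assumed equation into
  an averaging recursion with weight \<open>\<eta> / \<tau> (Suc k)\<close>. It serves
  \<open>A\<close> on the primal and the transpose of \<open>A\<close> on the dual iterates.\<close>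

lemma linear_image_tendsto_0_of_overshoot:
  fixes D \<psi> :: "nat \<Rightarrow> 'w::real_normed_vector"
  assumes F: "linear F"
    and D: "\<And>k. norm (D k) \<le> C" and \<psi>: "\<psi> \<longlonglongrightarrow> 0"
    and eq: "\<And>k. F (overshoot \<eta> \<tau> z k - p) = \<psi> k + (1 / \<tau> (Suc k)) *\<^sub>R (D (Suc k) - D k)"
  shows "(\<lambda>k. F (z (Suc k) - p)) \<longlonglongrightarrow> 0"
proof (rule averaging_bounded_increments_tendsto_0
    [OF \<tau>_ge_1 \<tau>_mono \<tau>_rate \<tau>_lim \<eta>_pos \<eta>_le1 not_summable_\<eta>_\<tau> _ \<psi>, of "\<lambda>k. \<eta> *\<^sub>R D k" "\<eta> * C"])
  show "norm (\<eta> *\<^sub>R D k) \<le> \<eta> * C" for k using D \<eta>_pos by simp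
  fix k
  let ?T = "\<tau> (Suc k)"
  have "(\<eta> / ?T) *\<^sub>R F (overshoot \<eta> \<tau> z k - p) = (1 / ?T) *\<^sub>R F (\<eta> *\<^sub>R (overshoot \<eta> \<tau> z k - p))"
    by (simp add: linear_cmul[OF F])
  also have "\<eta> *\<^sub>R (overshoot \<eta> \<tau> z k - p) = ?T *\<^sub>R (z (Suc (Suc k)) - p) - (?T - \<eta>) *\<^sub>R (z (Suc k) - p)"
    using overshoot_diff[of \<eta> \<tau> z k p] \<eta>_pos by (simp add: algebra_simps)
  also have "(1 / ?T) *\<^sub>R F \<dots> = F (z (Suc (Suc k)) - p) - (1 - \<eta> / ?T) *\<^sub>R F (z (Suc k) - p)"
    using \<tau>_pos[of "Suc k"] unfolding linear_diff[OF F, of "_ *\<^sub>R _"] linear_cmul[OF F]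
    by (simp add: scaleR_diff_right diff_divide_distrib)
  finally show "F (z (Suc (Suc k)) - p) = (1 - \<eta> / ?T) *\<^sub>R F (z (Suc k) - p) + (\<eta> / ?T) *\<^sub>R \<psi> k
      + (1 / ?T\<^sup>2) *\<^sub>R (\<eta> *\<^sub>R D (Suc k) - \<eta> *\<^sub>R D k)"
    unfolding eq by (simp add: algebra_simps power2_eq_square)
qed

section \<open>Asymptotic feasibility, limits of gradients and optimality of cluster points\<close>

context
  fixes xs :: "real^'n" and ls :: "real^'m"
  assumes kkt: "(xs, ls) \<in> kkt_set A b grad_f"
begin

lemma bounded_iterates: "bounded (range x)" "bounded (range l)"
  by (rule bounded_of_anchored, rule norm_anchored_bound[OF kkt])+

text \<open>The dual step expresses \<open>A\<close> at the primal overshoot through the dual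
  residual, which is an increment of the bounded dual drift divided by
  \<open>\<tau> (Suc k)\<close>.\<close>

lemma feasibility: "(\<lambda>k. A *v x k) \<longlonglongrightarrow> b"
proof -
  define C where "C = sqrt (\<delta> * energy xs ls 0)"
  have "(\<lambda>k. A *v (x (Suc k) - xs)) \<longlonglongrightarrow> 0"
  proof (rule linear_image_tendsto_0_of_overshoot[OF _ _ tendsto_const])
    show "norm ((1 / \<delta>) *\<^sub>R drift l ls k) \<le> (1 / \<delta>) * (C + (1 - \<eta>) * (C / \<eta>))" for k
      using drift_bounded[of l ls C k] norm_anchored_bound(2)[OF kkt] \<delta>_pos
      by (simp add: C_def divide_right_mono)
    show "A *v (overshoot \<eta> \<tau> x k - xs) = 0 + (1 / \<tau> (Suc k)) *\<^sub>R
        ((1 / \<delta>) *\<^sub>R drift l ls (Suc k) - (1 / \<delta>) *\<^sub>R drift l ls k)" for k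
      unfolding scaleR_diff_right[symmetric] drift_increment dual_step
      using \<delta>_pos \<tau>_pos[of "Suc k"]
      by (simp add: matrix_vector_mult_diff_distrib kkt_feasible[OF kkt])
  qed simp
  then have "(\<lambda>k. A *v x (Suc k) - b) \<longlonglongrightarrow> 0"
    by (simp add: matrix_vector_mult_diff_distrib kkt_feasible[OF kkt])
  then have "(\<lambda>k. A *v x (Suc k)) \<longlonglongrightarrow> b" by (simp add: LIM_zero_iff)
  then show ?thesis by (rule LIMSEQ_imp_Suc)
qed

text \<open>Feasibility passes to the limit, and the vanishing Lagrangian gap gives
  \<open>f w = f xs\<close>, so \<open>grad_eq_of_optimal\<close> applies.\<close>

lemma primal_cluster_point:
  assumes r: "filterlim r sequentially sequentially" and w: "(\<lambda>k. x (r k)) \<longlonglongrightarrow> w"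
  shows "A *v w = b" "grad_f w = - (transpose A *v ls)"
proof -
  have "(\<lambda>k. A *v x (r k)) \<longlonglongrightarrow> A *v w"
    by (rule bounded_linear.tendsto[OF matrix_vector_mul_bounded_linear w])
  moreover have "(\<lambda>k. A *v x (r k)) \<longlonglongrightarrow> b"
    by (rule filterlim_compose[OF feasibility r])
  ultimately show Aw: "A *v w = b" by (rule LIMSEQ_unique)
  have "(\<lambda>k. lagr ls (x k) - lagr ls xs) \<longlonglongrightarrow> 0"
    using lagr_gap_tendsto_0[OF kkt] LIMSEQ_imp_Suc[of "\<lambda>k. lagr ls (x k) - lagr ls xs"] by blast
  from filterlim_compose[OF this r]
  have "(\<lambda>k. lagr ls (x (r k))) \<longlonglongrightarrow> lagr ls xs" by (simp add: LIM_zero_iff)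
  moreover have "(\<lambda>k. lagr ls (x (r k))) \<longlonglongrightarrow> lagr ls w"
  proof -
    have "isCont f w" using has_derivative_continuous[OF f_grad] by blast
    then have "(\<lambda>k. f (x (r k))) \<longlonglongrightarrow> f w" using w by (rule isCont_tendsto_compose)
    then show ?thesis unfolding lagr_def
      by (intro tendsto_intros bounded_linear.tendsto[OF matrix_vector_mul_bounded_linear w])
  qed
  ultimately have "lagr ls w = lagr ls xs" using LIMSEQ_unique by blast
  then have "f w = f xs" by (simp add: lagr_def Aw kkt_feasible[OF kkt])
  then show "grad_f w = - (transpose A *v ls)"
    using grad_eq_of_optimal[OF kkt Aw] by simp
qed

text \<open>The points \<open>q k\<close> have the same cluster points as the iterates, and the
  gradient takes one common value at all of them; hence it converges before \<open>x\<close> is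
  known to.\<close>

lemma gradient_tendsto: "(\<lambda>k. grad_f (q k)) \<longlonglongrightarrow> - (transpose A *v ls)"
proof (rule tendsto_of_cluster_values[OF _ grad_cont])
  have "(\<lambda>k. q k - x (Suc (Suc k))) \<longlonglongrightarrow> 0"
    by (rule Lim_null_comparison[OF _ tendsto_norm_zero
          [OF inertial_residual_tendsto_0[OF norm_anchored_bound(1)[OF kkt]]]])
      (simp add: q_near)
  note diff = this
  have "bounded (range (\<lambda>k. (q k - x (Suc (Suc k))) + x (Suc (Suc k))))"
    using bounded_subset[OF bounded_iterates(1), of "range (\<lambda>k. x (Suc (Suc k)))"]
      convergent_imp_bounded[OF diff]
    by (intro bounded_plus_comp) auto
  then show "bounded (range q)" by simp
  fix r w assume r: "strict_mono (r :: nat \<Rightarrow> nat)" and w: "(q \<circ> r) \<longlonglongrightarrow> w"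
  have fr: "filterlim r sequentially sequentially" by (rule filterlim_subseq[OF r])
  have "(\<lambda>k. (q \<circ> r) k - (q (r k) - x (Suc (Suc (r k))))) \<longlonglongrightarrow> w - 0"
    by (intro tendsto_diff w filterlim_compose[OF diff fr])
  then have "(\<lambda>k. x (Suc (Suc (r k)))) \<longlonglongrightarrow> w" by simp
  moreover have "filterlim (\<lambda>k. Suc (Suc (r k))) sequentially sequentially"
    by (intro filterlim_compose[OF filterlim_Suc] fr)
  ultimately show "grad_f w = - (transpose A *v ls)" by (intro primal_cluster_point(2))
qed

text \<open>Counterpart of \<open>feasibility\<close> with the roles exchanged: the primal step is
  solved for the dual overshoot, and the primal drift supplies the bounded increments.\<close>

lemma dual_image_tendsto: "(\<lambda>k. transpose A *v l k) \<longlonglongrightarrow> transpose A *v ls"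
proof -
  define C where "C = sqrt (\<gamma> * energy xs ls 0)"
  \<comment> \<open>\<open>\<psi>\<close> gathers the gradient and penalty parts of the primal step;
    they vanish by \<open>gradient_tendsto\<close> and \<open>feasibility\<close>.\<close>
  define \<psi> where "\<psi> k = - (grad_f (q k) + transpose A *v ls
      + \<beta> *\<^sub>R (transpose A *v (A *v x (Suc (Suc k)) - b)))" for k
  have "\<psi> \<longlonglongrightarrow> - (- (transpose A *v ls) + transpose A *v ls + \<beta> *\<^sub>R (transpose A *v (b - b)))"
    unfolding \<psi>_def
    by (intro tendsto_intros gradient_tendsto
        bounded_linear.tendsto[OF matrix_vector_mul_bounded_linear, of _ _ _ "transpose A"]
        LIMSEQ_Suc[of "\<lambda>k. A *v x (Suc k)"] LIMSEQ_Suc[of "\<lambda>k. A *v x k"] feasibility)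
  then have \<psi>: "\<psi> \<longlonglongrightarrow> 0" by (simp del: transpose_matrix_vector)
  have "(\<lambda>k. transpose A *v (l (Suc k) - ls)) \<longlonglongrightarrow> 0"
  proof (rule linear_image_tendsto_0_of_overshoot[OF _ _ \<psi>])
    show "norm ((- 1 / \<gamma>) *\<^sub>R drift x xs k) \<le> (1 / \<gamma>) * (C + (1 - \<eta>) * (C / \<eta>))" for k
      using drift_bounded[of x xs C k] norm_anchored_bound(1)[OF kkt] \<gamma>_pos
      by (simp add: C_def divide_right_mono)
    show "transpose A *v (overshoot \<eta> \<tau> l k - ls) = \<psi> k + (1 / \<tau> (Suc k)) *\<^sub>R
        ((- 1 / \<gamma>) *\<^sub>R drift x xs (Suc k) - (- 1 / \<gamma>) *\<^sub>R drift x xs k)" for k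
      unfolding scaleR_diff_right[symmetric] drift_increment primal_step \<psi>_def
      using \<gamma>_pos \<tau>_pos[of "Suc k"]
      by (simp add: matrix_vector_mult_diff_distrib del: transpose_matrix_vector)
  qed (rule matrix_vector_mul_linear)
  then have "(\<lambda>k. transpose A *v l (Suc k) - transpose A *v ls) \<longlonglongrightarrow> 0"
    by (simp add: matrix_vector_mult_diff_distrib del: transpose_matrix_vector)
  then have "(\<lambda>k. transpose A *v l (Suc k)) \<longlonglongrightarrow> transpose A *v ls"
    by (simp add: LIM_zero_iff del: transpose_matrix_vector)
  then show ?thesis by (rule LIMSEQ_imp_Suc)
qed

text \<open>The gradient at \<open>w\<close> is known in terms of \<open>ls\<close>;
  \<open>m\<close> can replace \<open>ls\<close> because both have the same image under the
  transpose of \<open>A\<close>.\<close>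

lemma cluster_point_kkt:
  assumes r: "strict_mono (r :: nat \<Rightarrow> nat)"
    and "(\<lambda>k. x (r k)) \<longlonglongrightarrow> w" "(\<lambda>k. l (r k)) \<longlonglongrightarrow> m"
  shows "(w, m) \<in> kkt_set A b grad_f"
proof -
  have fr: "filterlim r sequentially sequentially" by (rule filterlim_subseq[OF r])
  have "(\<lambda>k. transpose A *v l (r k)) \<longlonglongrightarrow> transpose A *v m"
    by (rule bounded_linear.tendsto[OF matrix_vector_mul_bounded_linear assms(3)])
  moreover have "(\<lambda>k. transpose A *v l (r k)) \<longlonglongrightarrow> transpose A *v ls"
    by (rule filterlim_compose[OF dual_image_tendsto fr])
  ultimately have "transpose A *v m = transpose A *v ls" by (rule LIMSEQ_unique)
  then show ?thesis
    using primal_cluster_point[OF fr assms(2)] by (simp add: kkt_set_def del: transpose_matrix_vector)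
qed

end

section \<open>Uniqueness of the cluster point\<close>

text \<open>Solving the relaxed expression for \<open>a (Suc k)\<close> shows that
  \<open>a k - c\<close> is averaged with weight \<open>1 / \<tau> k\<close> against a null
  sequence.\<close>

lemma convergent_of_relaxed:
  fixes a :: "nat \<Rightarrow> real"
  assumes "convergent (\<lambda>k. a (Suc k) + (\<tau> k - 1) * (a (Suc k) - a k))"
  shows "convergent a"
proof -
  obtain c where c: "(\<lambda>k. a (Suc k) + (\<tau> k - 1) * (a (Suc k) - a k)) \<longlonglongrightarrow> c"
    using assms by (auto simp: convergent_def)
  define \<epsilon> where "\<epsilon> k = a (Suc k) + (\<tau> k - 1) * (a (Suc k) - a k) - c" for k
  have \<epsilon>: "\<epsilon> \<longlonglongrightarrow> 0" unfolding \<epsilon>_def using c by (simp add: LIM_zero_iff)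
  have "(\<lambda>k. \<bar>a k - c\<bar>) \<longlonglongrightarrow> 0"
  proof (rule averaging_le_tendsto_0[OF _ _ _ not_summable_inverse_\<tau> tendsto_rabs_zero[OF \<epsilon>]])
    fix k
    show s: "0 \<le> 1 / \<tau> k" "1 / \<tau> k \<le> 1" using \<tau>_ge_1[of k] by auto
    have "a (Suc k) - c = (1 - 1 / \<tau> k) * (a k - c) + 1 / \<tau> k * \<epsilon> k"
      unfolding \<epsilon>_def using \<tau>_pos[of k] by (simp add: field_simps)
    then have "\<bar>a (Suc k) - c\<bar> \<le> \<bar>(1 - 1 / \<tau> k) * (a k - c)\<bar> + \<bar>1 / \<tau> k * \<epsilon> k\<bar>" by linarith
    also have "\<dots> = (1 - 1 / \<tau> k) * \<bar>a k - c\<bar> + 1 / \<tau> k * \<bar>\<epsilon> k\<bar>"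
      using s by (simp only: abs_mult abs_of_nonneg diff_ge_0_iff_ge)
    finally show "\<bar>a (Suc k) - c\<bar> \<le> (1 - 1 / \<tau> k) * \<bar>a k - c\<bar> + 1 / \<tau> k * \<bar>\<epsilon> k\<bar>" .
  qed simp
  then have "a \<longlonglongrightarrow> c" by (simp add: tendsto_rabs_zero_iff LIM_zero_iff)
  then show ?thesis by (rule convergentI)
qed

text \<open>The squared distance to the anchor has total coefficient
  \<open>\<eta>\<^sup>2 + \<eta> * (1 - \<eta>) = \<eta>\<close>, and all terms quadratic in
  \<open>z\<close> are independent of the anchor and cancel.\<close>

lemma inertial_energy_anchor_diff:
  fixes z :: "nat \<Rightarrow> 'v::real_inner"
  shows "inertial_energy \<eta> \<tau> z p k - inertial_energy \<eta> \<tau> z p' k =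
    2 * \<eta> * ((p' - p) \<bullet> z (Suc k) + (\<tau> k - 1) * ((p' - p) \<bullet> z (Suc k) - (p' - p) \<bullet> z k))
    + \<eta> * ((norm p)\<^sup>2 - (norm p')\<^sup>2)"
  unfolding inertial_energy_def anchored_def power2_norm_eq_inner
  by (simp add: inner_add_left inner_add_right inner_diff_left inner_diff_right
      inner_commute[of "z (Suc k)" p] inner_commute[of "z (Suc k)" p'] inner_commute[of "z k" p]
      inner_commute[of "z k" p'] inner_commute[of "z k" "z (Suc k)"] algebra_simps)

text \<open>The gradient is constant on the solution set, so two multipliers differ by an element of the
  kernel of the transpose of \<open>A\<close>; the two Lagrangians then agree everywhere, and the difference of
  the energies is affine in the iterates.\<close>
lemma kkt_pair_functional_convergent:
  assumes kkt: "(xs, ls) \<in> kkt_set A b grad_f" and kkt': "(xs', ls') \<in> kkt_set A b grad_f"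
  shows "convergent (\<lambda>k. ((xs' - xs) \<bullet> x k) / \<gamma> + ((ls' - ls) \<bullet> l k) / \<delta>)"
proof (rule convergent_of_relaxed)
  define a where "a k = ((xs' - xs) \<bullet> x k) / \<gamma> + ((ls' - ls) \<bullet> l k) / \<delta>" for k
  \<comment> \<open>Both points are feasible, so the lower bound of each one, evaluated at the
    other, gives the two inequalities.\<close>
  have f_eq: "f xs' = f xs"
    using lagr_lower[OF kkt, of xs'] lagr_lower[OF kkt', of xs] kkt_feasible[OF kkt] kkt_feasible[OF kkt']
    by simp
  have "transpose A *v ls = transpose A *v ls'"
    using grad_eq_of_optimal[OF kkt kkt_feasible[OF kkt']] kkt_stationary[OF kkt'] f_eq by simp
  then have "ls \<bullet> (A *v y - b) = ls' \<bullet> (A *v y - b)" for y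
    unfolding kkt_feasible[OF kkt, symmetric] matrix_vector_mult_diff_distrib[symmetric]
      inner_transpose_left[symmetric] by simp
  then have lagr_eq: "lagr ls y = lagr ls' y" for y by (simp add: lagr_def)
  have gap_eq: "lagr ls y - lagr ls xs = lagr ls' y - lagr ls' xs'" for y
    by (simp add: lagr_eq lagr_anchor[OF kkt'] f_eq) (simp add: lagr_anchor[OF kkt] flip: lagr_eq)
  \<comment> \<open>\<open>K\<close> collects the terms that contain only the anchors and are
    therefore constant in \<open>k\<close>.\<close>
  define K where "K = \<eta> * ((norm xs)\<^sup>2 - (norm xs')\<^sup>2) / \<gamma> + \<eta> * ((norm ls)\<^sup>2 - (norm ls')\<^sup>2) / \<delta>"
  have "a (Suc k) + (\<tau> k - 1) * (a (Suc k) - a k)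
      = (energy xs ls k - energy xs' ls' k - K) * (1 / (2 * \<eta>))" for k
  proof -
    have "energy xs ls k - energy xs' ls' k =
        (inertial_energy \<eta> \<tau> x xs k - inertial_energy \<eta> \<tau> x xs' k) / \<gamma>
        + (inertial_energy \<eta> \<tau> l ls k - inertial_energy \<eta> \<tau> l ls' k) / \<delta>"
      unfolding energy_def gap_eq diff_divide_distrib by simp
    also have "\<dots> = 2 * \<eta> * (a (Suc k) + (\<tau> k - 1) * (a (Suc k) - a k)) + K"
      unfolding inertial_energy_anchor_diff a_def K_def using \<gamma>_pos \<delta>_pos
      by (simp add: field_simps)
    finally show ?thesis using \<eta>_pos by simp
  qed
  moreover have "convergent (\<lambda>k. (energy xs ls k - energy xs' ls' k - K) * (1 / (2 * \<eta>)))"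
    by (intro convergent_mult convergent_diff convergent_const convergent_energy[OF kkt]
        convergent_energy[OF kkt'])
  ultimately show "convergent (\<lambda>k. a (Suc k) + (\<tau> k - 1) * (a (Suc k) - a k))" by simp
qed

text \<open>Boundedness yields a cluster point, each cluster point is a KKT pair, and the convergent
  functional attached to two of them forces them to coincide.\<close>

theorem iterates_converge:
  assumes kkt: "(xs, ls) \<in> kkt_set A b grad_f"
  shows "\<exists>w m. (w, m) \<in> kkt_set A b grad_f \<and> x \<longlonglongrightarrow> w \<and> l \<longlonglongrightarrow> m"
proof -
  define z where "z k = (x k, l k)" for k
  have bdd: "bounded (range z)"
    using bounded_Times[OF bounded_iterates[OF kkt]]
    by (rule bounded_subset) (auto simp: z_def)
  have cluster: "(w, m) \<in> kkt_set A b grad_f"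
    if "strict_mono (r :: nat \<Rightarrow> nat)" "(z \<circ> r) \<longlonglongrightarrow> (w, m)" for r w m
    using tendsto_fst[OF that(2)] tendsto_snd[OF that(2)] that(1)
    by (intro cluster_point_kkt[OF kkt]) (auto simp: z_def)
  obtain r w m where r: "strict_mono (r :: nat \<Rightarrow> nat)" and wm: "(z \<circ> r) \<longlonglongrightarrow> (w, m)"
    using bounded_imp_convergent_subsequence[OF bdd] by (metis surj_pair)
  have unique: "v = (w, m)" if s: "strict_mono (s :: nat \<Rightarrow> nat)" and v: "(z \<circ> s) \<longlonglongrightarrow> v" for s v
  proof -
    obtain w' m' where v_eq: "v = (w', m')" by (cases v)
    \<comment> \<open>The functional points from one cluster point to the other: its values there
      differ by their weighted squared distance, yet both equal the limit \<open>c\<close>.\<close>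
    define \<phi> where "\<phi> u = ((w' - w) \<bullet> fst u) / \<gamma> + ((m' - m) \<bullet> snd u) / \<delta>" for u
    obtain c where c: "(\<lambda>k. \<phi> (z k)) \<longlonglongrightarrow> c"
      using kkt_pair_functional_convergent[OF cluster[OF r wm] cluster[OF s v[unfolded v_eq]]]
      by (auto simp: convergent_def \<phi>_def z_def)
    have lim: "\<phi> u = c" if "strict_mono (s :: nat \<Rightarrow> nat)" "(z \<circ> s) \<longlonglongrightarrow> u" for s u
    proof (rule LIMSEQ_unique)
      show "(\<lambda>k. \<phi> ((z \<circ> s) k)) \<longlonglongrightarrow> \<phi> u"
        unfolding \<phi>_def using \<gamma>_pos \<delta>_pos by (intro tendsto_intros that(2)) auto
      show "(\<lambda>k. \<phi> ((z \<circ> s) k)) \<longlonglongrightarrow> c"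
        using filterlim_compose[OF c filterlim_subseq[OF that(1)]] by simp
    qed
    have "\<phi> (w', m') - \<phi> (w, m) = 0" using lim[OF r wm] lim[OF s v] v_eq by simp
    moreover have "\<phi> (w', m') - \<phi> (w, m) = (norm (w' - w))\<^sup>2 / \<gamma> + (norm (m' - m))\<^sup>2 / \<delta>"
      unfolding \<phi>_def power2_norm_eq_inner
      by (simp add: inner_diff_right diff_divide_distrib)
    ultimately have "(norm (w' - w))\<^sup>2 / \<gamma> + (norm (m' - m))\<^sup>2 / \<delta> = 0" by simp
    then have "w' = w \<and> m' = m"
      using \<gamma>_pos \<delta>_pos by (subst (asm) add_nonneg_eq_0_iff) auto
    then show ?thesis using v_eq by simp
  qed
  have "z \<longlonglongrightarrow> (w, m)"
    using tendsto_of_cluster_values[OF bdd continuous_on_id unique] .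
  from tendsto_fst[OF this] tendsto_snd[OF this] cluster[OF r wm]
  show ?thesis by (auto simp: z_def)
qed

end

section \<open>The accelerated augmented Lagrangian method\<close>

text \<open>Fermat's rule for the subproblem. Keeping the derivative \<open>v\<close> of the smooth
  part abstract covers both cases of the method.\<close>

lemma aalm_obj_minimizer_stationary:
  fixes A :: "real^'n^'m"
  assumes g: "(g has_derivative (\<lambda>h. v \<bullet> h)) (at y)"
    and min: "\<And>y'. aalm_obj g A b \<beta> \<gamma> \<delta> xb p c r y \<le> aalm_obj g A b \<beta> \<gamma> \<delta> xb p c r y'"
  shows "v + \<beta> *\<^sub>R (transpose A *v (A *v y - b)) + (1 / \<gamma>) *\<^sub>R (y - xb)
    + transpose A *v (p + (\<delta> * c) *\<^sub>R (c *\<^sub>R (A *v y) - r)) = 0"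
proof -
  define w where "w = v + \<beta> *\<^sub>R (transpose A *v (A *v y - b)) + (1 / \<gamma>) *\<^sub>R (y - xb)
    + transpose A *v (p + (\<delta> * c) *\<^sub>R (c *\<^sub>R (A *v y) - r))"
  have sq: "((\<lambda>y. (norm (F y))\<^sup>2) has_derivative (\<lambda>h. 2 * (F y \<bullet> F' h))) (at y)"
    if "(F has_derivative F') (at y)" for F F' :: "real^'n \<Rightarrow> 'z::real_inner"
    unfolding power2_norm_eq_inner
    by (rule has_derivative_eq_rhs[OF has_derivative_inner[OF that that]])
      (simp add: fun_eq_iff inner_commute)
  have A: "((\<lambda>y. A *v y) has_derivative (\<lambda>h. A *v h)) (at y)"
    by (rule bounded_linear_imp_has_derivative) simp
  have "((\<lambda>y. aalm_obj g A b \<beta> \<gamma> \<delta> xb p c r y) has_derivative (\<lambda>h. w \<bullet> h)) (at y)"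
    unfolding aalm_obj_def
  proof (rule has_derivative_eq_rhs)
    \<comment> \<open>The derivative is first stated in the shape produced by the differentiation
      rules, with the zero derivatives of constants still present; the second goal rewrites it to
      \<open>w\<close>.\<close>
    show "((\<lambda>y. g y + \<beta> / 2 * (norm (A *v y - b))\<^sup>2 + 1 / (2 * \<gamma>) * (norm (y - xb))\<^sup>2
         + p \<bullet> (A *v y - b) + \<delta> / 2 * (norm (c *\<^sub>R (A *v y) - r))\<^sup>2) has_derivative
       (\<lambda>h. v \<bullet> h + \<beta> / 2 * (2 * ((A *v y - b) \<bullet> (A *v h - 0)))
         + 1 / (2 * \<gamma>) * (2 * ((y - xb) \<bullet> (h - 0)))
         + p \<bullet> (A *v h - 0) + \<delta> / 2 * (2 * ((c *\<^sub>R (A *v y) - r) \<bullet> (c *\<^sub>R (A *v h) - 0))))) (at y)"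
      by (intro has_derivative_add g has_derivative_mult_right sq has_derivative_diff A
          has_derivative_const has_derivative_ident has_derivative_inner_right
          has_derivative_scaleR_right)
    show "(\<lambda>h. v \<bullet> h + \<beta> / 2 * (2 * ((A *v y - b) \<bullet> (A *v h - 0)))
         + 1 / (2 * \<gamma>) * (2 * ((y - xb) \<bullet> (h - 0)))
         + p \<bullet> (A *v h - 0) + \<delta> / 2 * (2 * ((c *\<^sub>R (A *v y) - r) \<bullet> (c *\<^sub>R (A *v h) - 0))))
       = (\<lambda>h. w \<bullet> h)"
      unfolding w_def inner_add_left inner_scaleR_left inner_transpose_left
      by (auto simp: fun_eq_iff)
  qed
  then have "(\<lambda>h. w \<bullet> h) = (\<lambda>h. 0)"
    by (rule differential_zero_maxmin[OF UNIV_I open_UNIV]) (use min in blast)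
  then show ?thesis by (metis w_def inner_eq_zero_iff)
qed

text \<open>Because \<open>c - \<alpha> = 1\<close>, the scaled constraint residual is the one at
  the primal overshoot. Inserting the dual update into the multiplier term of the optimality
  condition cancels the extrapolated multiplier and leaves the dual overshoot.\<close>

lemma aalm_step_equations:
  fixes A :: "real^'n^'m" and t :: "nat \<Rightarrow> real"
  defines "\<tau> \<equiv> \<lambda>k. t (Suc k)"
  assumes step: "aalm_step G A b t \<eta> \<beta> \<gamma> \<delta> x l (Suc k)"
    and G: "(G (inertial \<tau> x k) has_derivative (\<lambda>h. v \<bullet> h)) (at (x (Suc (Suc k))))"
    and nz: "\<eta> \<noteq> 0" "\<gamma> \<noteq> 0"
  shows "x (Suc (Suc k)) - inertial \<tau> x k =
      - \<gamma> *\<^sub>R (v + \<beta> *\<^sub>R (transpose A *v (A *v x (Suc (Suc k)) - b))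
              + transpose A *v overshoot \<eta> \<tau> l k)"
    and "l (Suc (Suc k)) - inertial \<tau> l k = \<delta> *\<^sub>R (A *v overshoot \<eta> \<tau> x k - b)"
proof -
  define c where "c = \<tau> (Suc k) / \<eta>"
  define \<alpha> where "\<alpha> = (\<tau> (Suc k) - \<eta>) / \<eta>"
  define p where "p = c *\<^sub>R inertial \<tau> l k - \<alpha> *\<^sub>R l (Suc k)"
  define r where "r = \<alpha> *\<^sub>R (A *v x (Suc k)) + b"
  have \<alpha>: "\<alpha> = c - 1" using nz by (simp add: \<alpha>_def c_def diff_divide_distrib)
  have xb: "x (Suc k) + ((t (Suc k) - 1) / t (Suc k + 1)) *\<^sub>R (x (Suc k) - x (Suc k - 1)) = inertial \<tau> x k"
    and lb: "l (Suc k) + ((t (Suc k) - 1) / t (Suc k + 1)) *\<^sub>R (l (Suc k) - l (Suc k - 1)) = inertial \<tau> l k"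
    by (simp_all add: inertial_def \<tau>_def)
  note step' = step[unfolded aalm_step_def Let_def xb lb]
  have obj: "aalm_obj (G (inertial \<tau> x k)) A b \<beta> \<gamma> \<delta> (inertial \<tau> x k) p c r (x (Suc (Suc k)))
      \<le> aalm_obj (G (inertial \<tau> x k)) A b \<beta> \<gamma> \<delta> (inertial \<tau> x k) p c r y" for y
    using step' by (simp add: p_def r_def c_def \<alpha>_def \<tau>_def)
  have dual: "l (Suc (Suc k)) = inertial \<tau> l k + \<delta> *\<^sub>R (c *\<^sub>R (A *v x (Suc (Suc k))) - r)"
    using step' by (simp add: r_def c_def \<alpha>_def \<tau>_def)
  have res: "c *\<^sub>R (A *v x (Suc (Suc k))) - r = A *v overshoot \<eta> \<tau> x k - b"
    unfolding overshoot_def c_def[symmetric] r_def \<alpha> by (simp add: algebra_simps)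
  show "l (Suc (Suc k)) - inertial \<tau> l k = \<delta> *\<^sub>R (A *v overshoot \<eta> \<tau> x k - b)"
    using dual unfolding res by simp
  have "(\<delta> * c) *\<^sub>R (c *\<^sub>R (A *v x (Suc (Suc k))) - r) = c *\<^sub>R (l (Suc (Suc k)) - inertial \<tau> l k)"
    using dual by (simp add: mult.commute)
  then have mult: "p + (\<delta> * c) *\<^sub>R (c *\<^sub>R (A *v x (Suc (Suc k))) - r) = overshoot \<eta> \<tau> l k"
    unfolding overshoot_def c_def[symmetric] p_def \<alpha> by (simp add: algebra_simps)
  define w where "w = v + \<beta> *\<^sub>R (transpose A *v (A *v x (Suc (Suc k)) - b))
      + transpose A *v overshoot \<eta> \<tau> l k"
  define e where "e = x (Suc (Suc k)) - inertial \<tau> x k"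
  have "w + (1 / \<gamma>) *\<^sub>R e = 0"
    using aalm_obj_minimizer_stationary[OF G obj] unfolding mult w_def e_def by (simp only: add_ac)
  then have "\<gamma> *\<^sub>R (w + (1 / \<gamma>) *\<^sub>R e) = 0" by simp
  then have "e + \<gamma> *\<^sub>R w = 0"
    using nz by (simp add: scaleR_add_right add.commute)
  then have "e = - \<gamma> *\<^sub>R w"
    by (simp add: eq_neg_iff_add_eq_0)
  then show "x (Suc (Suc k)) - inertial \<tau> x k =
      - \<gamma> *\<^sub>R (v + \<beta> *\<^sub>R (transpose A *v (A *v x (Suc (Suc k)) - b))
              + transpose A *v overshoot \<eta> \<tau> l k)"
    unfolding w_def e_def .
qed

theorem theorem4p2:
  fixes f :: "real^'n \<Rightarrow> real" and grad_f :: "real^'n \<Rightarrow> real^'n"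
    and A :: "real^'n^'m" and b :: "real^'m"
    and t :: "nat \<Rightarrow> real" and \<rho> \<eta> \<gamma> \<delta> \<beta> :: real
    and x :: "nat \<Rightarrow> real^'n" and l :: "nat \<Rightarrow> real^'m"
  assumes f_convex: "convex_on UNIV f"
    and f_grad: "\<And>z. (f has_derivative (\<lambda>h. grad_f z \<bullet> h)) (at z)"
    and f_C1: "continuous_on UNIV grad_f"
    and kkt_nonempty: "kkt_set A b grad_f \<noteq> {}"
    and t_mono: "\<And>k. k \<ge> 1 \<Longrightarrow> t k \<le> t (k+1)"
    and t_1: "t 1 = 1"
    and t_gt1: "\<And>k. k > 2 \<Longrightarrow> t k > 1"
    and t_lim: "filterlim t at_top sequentially"
    and t_rate: "\<And>k. k \<ge> 1 \<Longrightarrow> (t (k+1))\<^sup>2 - (t k)\<^sup>2 \<le> \<rho> * t (k+1)"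
    and \<rho>_pos: "0 < \<rho>" and \<rho>_le1: "\<rho> \<le> 1"
    and \<eta>_ge: "\<rho> \<le> \<eta>" and \<eta>_le1: "\<eta> \<le> 1"
    and \<gamma>_pos: "0 < \<gamma>" and \<delta>_pos: "0 < \<delta>" and \<beta>_nonneg: "0 \<le> \<beta>"
    and x_init: "x 0 = x 1" and l_init: "l 0 = l 1"
    and iter: "(\<forall>k\<ge>1. aalm_step (\<lambda>xb. f) A b t \<eta> \<beta> \<gamma> \<delta> x l k)
             \<or> (\<exists>L. L-lipschitz_on UNIV grad_f \<and> \<gamma> * L \<le> 1 \<and>
                  (\<forall>k\<ge>1. aalm_step (\<lambda>xb y. grad_f xb \<bullet> y) A b t \<eta> \<beta> \<gamma> \<delta> x l k))"
  shows "\<exists>xs ls. (xs, ls) \<in> kkt_set A b grad_f \<and> x \<longlonglongrightarrow> xs \<and> l \<longlonglongrightarrow> ls"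
proof -
  define \<tau> where "\<tau> = (\<lambda>k. t (Suc k))"
  have \<tau>: "\<tau> 0 = 1" "\<And>k. \<tau> k \<le> \<tau> (Suc k)" "filterlim \<tau> at_top sequentially"
    using t_1 t_mono[of "Suc _"] filterlim_compose[OF t_lim filterlim_Suc] by (auto simp: \<tau>_def)
  have \<tau>_ge: "1 \<le> \<tau> k" for k
    using lift_Suc_mono_le[of \<tau> 0 k] \<tau> by simp
  \<comment> \<open>As \<open>\<tau>\<close> is positive and \<open>\<rho> \<le> \<eta>\<close>, the
    given rate implies the one with \<open>\<eta>\<close> used in the energy estimate.\<close>
  have \<tau>_rate: "(\<tau> (Suc k))\<^sup>2 - (\<tau> k)\<^sup>2 \<le> \<eta> * \<tau> (Suc k)" for k
  proof -
    have "\<rho> * \<tau> (Suc k) \<le> \<eta> * \<tau> (Suc k)"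
      using \<eta>_ge \<tau>_ge[of "Suc k"] by (intro mult_right_mono) auto
    then show ?thesis using t_rate[of "Suc k"] by (simp add: \<tau>_def)
  qed
  have \<eta>_pos: "0 < \<eta>" using \<rho>_pos \<eta>_ge by simp
  then have nz: "\<eta> \<noteq> 0" "\<gamma> \<noteq> 0" using \<gamma>_pos by auto
  \<comment> \<open>The witness is the new iterate in Case I and the extrapolated point in Case II;
    from there on the two cases share one argument.\<close>
  have "\<exists>q. inertial_primal_dual f grad_f A b \<tau> \<eta> \<gamma> \<delta> \<beta> x l q"
    using iter
  proof (elim disjE exE conjE)
    assume steps: "\<forall>k\<ge>1. aalm_step (\<lambda>xb. f) A b t \<eta> \<beta> \<gamma> \<delta> x l k"
    have "aalm_step (\<lambda>xb. f) A b t \<eta> \<beta> \<gamma> \<delta> x l (Suc k)" for k using steps by simp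
    note eqs = aalm_step_equations[OF this f_grad nz, folded \<tau>_def]
    have "inertial_primal_dual f grad_f A b \<tau> \<eta> \<gamma> \<delta> \<beta> x l (\<lambda>k. x (Suc (Suc k)))"
    proof
      fix k y
      have "f (x (Suc (Suc k))) - f y \<le> grad_f (x (Suc (Suc k))) \<bullet> (x (Suc (Suc k)) - y)"
        using convex_above_gradient[OF f_convex f_grad, of "x (Suc (Suc k))" y]
        by (simp add: inner_diff_right)
      moreover have "0 \<le> 1 / (2 * \<gamma>) * (norm (x (Suc (Suc k)) - inertial \<tau> x k))\<^sup>2"
        using \<gamma>_pos by simp
      ultimately show "f (x (Suc (Suc k))) - f y
          - 1 / (2 * \<gamma>) * (norm (x (Suc (Suc k)) - inertial \<tau> x k))\<^sup>2
          \<le> grad_f (x (Suc (Suc k))) \<bullet> (x (Suc (Suc k)) - y)" by linarith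
    qed (rule f_convex f_grad f_C1 \<tau> \<tau>_rate \<eta>_pos \<eta>_le1 \<gamma>_pos \<delta>_pos \<beta>_nonneg eqs
        | simp add: norm_minus_commute)+
    then show ?thesis by blast
  next
    fix L
    assume L: "L-lipschitz_on UNIV grad_f" "\<gamma> * L \<le> 1"
      and steps: "\<forall>k\<ge>1. aalm_step (\<lambda>xb y. grad_f xb \<bullet> y) A b t \<eta> \<beta> \<gamma> \<delta> x l k"
    have step: "aalm_step (\<lambda>xb y. grad_f xb \<bullet> y) A b t \<eta> \<beta> \<gamma> \<delta> x l (Suc k)" for k using steps by simp
    have "((\<lambda>y. grad_f z \<bullet> y) has_derivative (\<lambda>h. grad_f z \<bullet> h)) (at w)" for z w
      by (rule bounded_linear_imp_has_derivative[OF bounded_linear_inner_right])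
    note eqs = aalm_step_equations[OF step this nz, folded \<tau>_def]
    have "inertial_primal_dual f grad_f A b \<tau> \<eta> \<gamma> \<delta> \<beta> x l (inertial \<tau> x)"
    proof
      fix k y
      let ?X = "x (Suc (Suc k))" and ?Y = "inertial \<tau> x k"
      \<comment> \<open>The descent inequality compares the new iterate with the extrapolated point,
        and convexity compares the latter with \<open>y\<close>; \<open>\<gamma> * L \<le> 1\<close>
        converts \<open>L / 2\<close> into the proximal coefficient.\<close>
      have "f ?X \<le> f ?Y + grad_f ?Y \<bullet> (?X - ?Y) + L / 2 * (norm (?X - ?Y))\<^sup>2"
        by (rule lipschitz_gradient_descent[OF f_grad L(1)])
      moreover have "L / 2 * (norm (?X - ?Y))\<^sup>2 \<le> 1 / (2 * \<gamma>) * (norm (?X - ?Y))\<^sup>2"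
        using L(2) \<gamma>_pos by (intro mult_right_mono) (auto simp: field_simps)
      moreover have "f ?Y + grad_f ?Y \<bullet> (y - ?Y) \<le> f y"
        by (rule convex_above_gradient[OF f_convex f_grad])
      ultimately show "f ?X - f y - 1 / (2 * \<gamma>) * (norm (?X - ?Y))\<^sup>2 \<le> grad_f ?Y \<bullet> (?X - y)"
        by (simp add: inner_diff_right)
    qed (rule f_convex f_grad f_C1 \<tau> \<tau>_rate \<eta>_pos \<eta>_le1 \<gamma>_pos \<delta>_pos \<beta>_nonneg eqs
        | simp add: norm_minus_commute)+
    then show ?thesis by blast
  qed
  then obtain q where "inertial_primal_dual f grad_f A b \<tau> \<eta> \<gamma> \<delta> \<beta> x l q" ..
  then interpret inertial_primal_dual f grad_f A b \<tau> \<eta> \<gamma> \<delta> \<beta> x l q .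
  obtain xs ls where "(xs, ls) \<in> kkt_set A b grad_f"
    using kkt_nonempty by auto
  then show ?thesis by (rule iterates_converge)
qed

end
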